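(* Let $N$ be a positive integer and let $d\neq1$ be a divisor of $N$. Let $C_d=\varphi(\gcd(d,N/d))\cdot(P_1)-(P_d)$ on $X_0(N)$. Then $$\mathsf{GCD}(C_d)=\mathfrak{g}(N,d)\quad\text{and}\quad\mathfrak{h}(C_d)=\mathfrak{h}(N,d),$$ where $\mathfrak{g}(N,d)$ and $\mathfrak{h}(N,d)$ are as follows. If $d=N$, then $\mathfrak{g}(N,N)=\mathfrak{g}(N)$ and $\mathfrak{h}(N,N)=\mathfrak{h}(N)$. If $d\ne N$, put $z=\gcd(d,N/d)$; then: 1. $\mathfrak{g}(N,d)=\mathfrak{g}(d)$ if $z=1$; 2. $\mathfrak{g}(N,d)=\gcd(p,\mathfrak{g}(d/p))$ if $z=p$ is a prime and $\mathrm{val}_p(d)=1$; 3. $\mathfrak{g}(N,d)=\frac{z}{\mathrm{rad}(z)}$ otherwise. Also, for $d\neq N$, $\mathfrak{h}(N,d)=2$ if one of the following holds, and $\mathfrak{h}(N,d)=1$ otherwise: 1. $N=2^r$ with $r\ge2$ and $d=2$; 2. $N=2^r$ with $r\ge2$ and $d=2^f$ with $f$ even; 3. $N=2^rp$ with $r\ge2$ and $d=2p$, where $p\equiv1\pmod4$ is a prime; 4. $N=2^rd$ with $r\ge1$ and $d=p$, where $p$ is an odd prime; 5. $N=2^rd$ with $r\ge1$ and $d=pq$, where $p,q$ are two distinct odd primes such that $\mathrm{val}_2(p-1)=\mathrm{val}_2(q-1)$ and $\mathrm{val}_2(p+1)=\mathrm{val}_2(q+1)$.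
   Context: **The one-variable functions.** $\mathfrak{g}(1)=0$; $\mathfrak{g}(M)=\gcd(M+(-1)^{t-1},\,p_i^2-1:1\le i\le t)$ if $M=\prod_{i=1}^tp_i>1$ is squarefree; $\mathfrak{g}(M)=\gcd(p,\mathfrak{g}(M'))$ if $M=M'p^2$ with $p$ prime, $\gcd(M',p)=1$ and $M'$ squarefree; $\mathfrak{g}(M)=1$ otherwise. $\mathfrak{h}(M)=2$ if $M$ is prime; or $M=2^r$ with $r$ odd; or $M=pq$ for distinct odd primes with $\mathrm{val}_2(p-1)=\mathrm{val}_2(q-1)$ and $\mathrm{val}_2(p+1)=\mathrm{val}_2(q+1)$; or $M=4p$ with $p$ a prime congruent to $1$ modulo $4$; and $\mathfrak{h}(M)=1$ otherwise. $\mathrm{rad}(z)$ is the product of the primes dividing $z$. **Divisors and invariants.** For $d\mid N$, a cusp of $X_0(N)$ is of level $d$ if it is represented by $x/d$ with $\gcd(x,d)=1$; $(P_d)$ is the sum of all cusps of level $d$, each with multiplicity one. For a prime $p$ and $r\ge1$, with $m(j)=\min(j,r-j)$, let $\Upsilon(p^r)$ be the matrix indexed by divisors of $p^r$ with $\Upsilon(p^r)_{p^ip^j}=p$ if $i=j\in\{0,r\}$; $p^{m(j)-1}(p^2+1)$ if $1\le i=j\le r-1$; $-p^{m(j)}$ if $|i-j|=1$; $0$ if $|i-j|\ge2$. For $N=\prod p_i^{r_i}$, $\delta=\prod p_i^{e_i}$, $d=\prod p_i^{f_i}$, put $\Upsilon(N)_{\delta d}=\prod_i\Upsilon(p_i^{r_i})_{p_i^{e_i}p_i^{f_i}}$.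 For nonzero $C=\sum_{d\mid N} a_d(P_d)$ ($a_d\in\mathbf{Z}$): $V(C)_\delta=\sum_{d\mid N}\Upsilon(N)_{\delta d}\,a_d$; $\mathsf{GCD}(C)$ is the greatest common divisor of the entries $V(C)_\delta$, $\delta\mid N$; $\mathbb{V}(C)=\mathsf{GCD}(C)^{-1}V(C)$; for a prime $p$, $\mathsf{Pw}_p(C)=\sum_{\delta\mid N,\ \mathrm{val}_p(\delta)\ \text{odd}}\mathbb{V}(C)_\delta$; $\mathfrak{h}(C)=1$ if $\mathsf{Pw}_p(C)$ is even for all primes $p$, and $\mathfrak{h}(C)=2$ otherwise. *)

theory Defs
  imports
    "HOL-Library.Poly_Mapping"
    "HOL-Computational_Algebra.Squarefree"
    "HOL-Number_Theory.Totient"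
begin

section \<open>Cusps of \<open>X\<^sub>0(N)\<close> and divisors supported on them\<close>

text \<open>
  A point \<open>x/y\<close> of \<open>P\<^sup>1(Q)\<close> (with \<open>1/0\<close> for infinity) is a primitive integer vector \<open>(x, y)\<close>
  up to sign. Since \<open>-1\<close> lies in \<open>\<Gamma>\<^sub>0(N)\<close>, the cusps of \<open>X\<^sub>0(N)\<close>, i.e. the
  \<open>\<Gamma>\<^sub>0(N)\<close>-orbits on \<open>P\<^sup>1(Q)\<close>, correspond to the \<open>\<Gamma>\<^sub>0(N)\<close>-orbits on primitive vectors.
  The tuple \<open>(a, b, c, e)\<close> stands for the matrix with rows \<open>(a, b)\<close> and \<open>(c, e)\<close>.
\<close>

definition primitive_vectors :: "(int \<times> int) set" where
  "primitive_vectors = {(x, y). coprime x y}"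

definition Gamma0 :: "nat \<Rightarrow> (int \<times> int \<times> int \<times> int) set" where
  "Gamma0 N = {(a, b, c, e). a * e - b * c = 1 \<and> int N dvd c}"

definition Gamma0_rel :: "nat \<Rightarrow> ((int \<times> int) \<times> (int \<times> int)) set" where
  "Gamma0_rel N = {((x, y), (x', y')). (x, y) \<in> primitive_vectors \<and> (x', y') \<in> primitive_vectors \<and>
     (\<exists>(a, b, c, e) \<in> Gamma0 N. x' = a * x + b * y \<and> y' = c * x + e * y)}"

type_synonym cusp = "(int \<times> int) set"

definition cusps :: "nat \<Rightarrow> cusp set" where
  "cusps N = primitive_vectors // Gamma0_rel N"

definition cusps_of_level :: "nat \<Rightarrow> nat \<Rightarrow> cusp set" where
  "cusps_of_level N d = {\<kappa> \<in> cusps N. \<exists>x. coprime x (int d) \<and> (x, int d) \<in> \<kappa>}"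

text \<open>Divisors supported on cusps are elements of the free abelian group over the cusps.\<close>

type_synonym cusp_divisor = "cusp \<Rightarrow>\<^sub>0 int"

definition P_div :: "nat \<Rightarrow> nat \<Rightarrow> cusp_divisor" where
  "P_div N d = (\<Sum>\<kappa>\<in>cusps_of_level N d. frag_of \<kappa>)"

text \<open>
  The coefficients \<open>a\<^sub>d\<close> in \<open>C = (\<Sum>d | d dvd N. a\<^sub>d (P\<^sub>d))\<close>, extended by zero to non-divisors of \<open>N\<close>.
  They are unique (lemma \<open>level_coeffs_eqI\<close> below); the value is irrelevant
  if \<open>C\<close> is not of this form.
\<close>

definition level_coeffs :: "nat \<Rightarrow> cusp_divisor \<Rightarrow> nat \<Rightarrow> int" where
  "level_coeffs N C = (THE a. (\<forall>d. \<not> d dvd N \<longrightarrow> a d = 0) \<and>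
     C = (\<Sum>d | d dvd N. frag_cmul (a d) (P_div N d)))"

definition C_div :: "nat \<Rightarrow> nat \<Rightarrow> cusp_divisor" where
  "C_div N d = frag_cmul (int (totient (gcd d (N div d)))) (P_div N 1) - P_div N d"


section \<open>The invariants \<open>GCD(C)\<close> and \<open>h(C)\<close>\<close>

text \<open>\<open>Upsilon_pp p r i j\<close> is the entry of \<open>\<Upsilon>(p\<^sup>r)\<close> at \<open>(p\<^sup>i, p\<^sup>j)\<close>, for \<open>i, j \<le> r\<close> and \<open>r \<ge> 1\<close>.\<close>

definition Upsilon_pp :: "nat \<Rightarrow> nat \<Rightarrow> nat \<Rightarrow> nat \<Rightarrow> int" where
  "Upsilon_pp p r i j =
     (let m = min j (r - j) in
      if i = j then
        (if j = 0 \<or> j = r then int p else int p ^ (m - 1) * ((int p)\<^sup>2 + 1))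
      else if i = j + 1 \<or> j = i + 1 then - (int p ^ m)
      else 0)"

definition Upsilon :: "nat \<Rightarrow> nat \<Rightarrow> nat \<Rightarrow> int" where
  "Upsilon N \<delta> d = (\<Prod>p\<in>prime_factors N.
     Upsilon_pp p (multiplicity p N) (multiplicity p \<delta>) (multiplicity p d))"

definition V_div :: "nat \<Rightarrow> cusp_divisor \<Rightarrow> nat \<Rightarrow> int" where
  "V_div N C \<delta> = (\<Sum>d | d dvd N. Upsilon N \<delta> d * level_coeffs N C d)"

definition GCD_div :: "nat \<Rightarrow> cusp_divisor \<Rightarrow> int" where
  "GCD_div N C = Gcd (V_div N C ` {\<delta>. \<delta> dvd N})"

text \<open>The division is exact.\<close>

definition VV_div :: "nat \<Rightarrow> cusp_divisor \<Rightarrow> nat \<Rightarrow> int" where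
  "VV_div N C \<delta> = V_div N C \<delta> div GCD_div N C"

definition Pw_div :: "nat \<Rightarrow> nat \<Rightarrow> cusp_divisor \<Rightarrow> int" where
  "Pw_div N p C = (\<Sum>\<delta> | \<delta> dvd N \<and> odd (multiplicity p \<delta>). VV_div N C \<delta>)"

definition h_div :: "nat \<Rightarrow> cusp_divisor \<Rightarrow> nat" where
  "h_div N C = (if \<forall>p. prime p \<longrightarrow> even (Pw_div N p C) then 1 else 2)"


section \<open>The explicit functions \<open>g\<close> and \<open>h\<close>\<close>

definition g_squarefree :: "nat \<Rightarrow> int" where
  "g_squarefree M =
     (if M = 1 then 0
      else Gcd (insert (int M + (- 1) ^ (card (prime_factors M) - 1))
                       ((\<lambda>p. (int p)\<^sup>2 - 1) ` prime_factors M)))"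

text \<open>In the second case \<open>p\<close> and \<open>M'\<close> are determined by \<open>M\<close>.\<close>

definition g1 :: "nat \<Rightarrow> int" where
  "g1 M =
     (if squarefree M then g_squarefree M
      else if \<exists>p M'. prime p \<and> M = M' * p\<^sup>2 \<and> coprime M' p \<and> squarefree M' then
        (THE v. \<exists>p M'. prime p \<and> M = M' * p\<^sup>2 \<and> coprime M' p \<and> squarefree M' \<and>
           v = gcd (int p) (g_squarefree M'))
      else 1)"

definition same_2_valuations :: "nat \<Rightarrow> nat \<Rightarrow> bool" where
  "same_2_valuations p q \<longleftrightarrow>
     multiplicity 2 (p - 1) = multiplicity 2 (q - 1) \<and>
     multiplicity 2 (p + 1) = multiplicity 2 (q + 1)"

definition h1 :: "nat \<Rightarrow> nat" where
  "h1 M =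
     (if prime M \<or>
         (\<exists>r. odd r \<and> M = 2 ^ r) \<or>
         (\<exists>p q. prime p \<and> prime q \<and> odd p \<and> odd q \<and> p \<noteq> q \<and> M = p * q \<and> same_2_valuations p q) \<or>
         (\<exists>p. prime p \<and> [p = 1] (mod 4) \<and> M = 4 * p)
      then 2 else 1)"

definition rad :: "nat \<Rightarrow> nat" where
  "rad z = \<Prod>(prime_factors z)"

definition g2 :: "nat \<Rightarrow> nat \<Rightarrow> int" where
  "g2 N d =
     (if d = N then g1 N
      else let z = gcd d (N div d) in
        if z = 1 then g1 d
        else if prime z \<and> multiplicity z d = 1 then gcd (int z) (g1 (d div z))
        else int (z div rad z))"

definition h2 :: "nat \<Rightarrow> nat \<Rightarrow> nat" where
  "h2 N d =
     (if d = N then h1 N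
      else if
         (\<exists>r\<ge>2. N = 2 ^ r \<and> d = 2) \<or>
         (\<exists>r\<ge>2. N = 2 ^ r \<and> (\<exists>f. even f \<and> d = 2 ^ f)) \<or>
         (\<exists>r\<ge>2. \<exists>p. prime p \<and> [p = 1] (mod 4) \<and> N = 2 ^ r * p \<and> d = 2 * p) \<or>
         (\<exists>r\<ge>1. N = 2 ^ r * d \<and> prime d \<and> odd d) \<or>
         (\<exists>r\<ge>1. \<exists>p q. prime p \<and> prime q \<and> odd p \<and> odd q \<and> p \<noteq> q \<and>
            N = 2 ^ r * d \<and> d = p * q \<and> same_2_valuations p q)
      then 2 else 1)"


section \<open>Well-definedness of the coefficients\<close>

lemma equiv_Gamma0_rel: "equiv primitive_vectors (Gamma0_rel N)"
proof (rule equivI)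
  show "refl_on primitive_vectors (Gamma0_rel N)"
  proof (rule refl_onI)
    fix v assume "v \<in> primitive_vectors"
    moreover have "(1, 0, 0, 1) \<in> Gamma0 N" by (simp add: Gamma0_def)
    ultimately show "(v, v) \<in> Gamma0_rel N"
      unfolding Gamma0_rel_def by (cases v) force
  qed
  show "Gamma0_rel N \<subseteq> primitive_vectors \<times> primitive_vectors"
    unfolding Gamma0_rel_def by auto
  show "sym (Gamma0_rel N)"
  proof (rule symI)
    fix v w assume "(v, w) \<in> Gamma0_rel N"
    then obtain x y x' y' a b c e where
      vw: "v = (x, y)" "w = (x', y')" "v \<in> primitive_vectors" "w \<in> primitive_vectors"
      and G: "a * e - b * c = 1" "int N dvd c" "x' = a * x + b * y" "y' = c * x + e * y"
      unfolding Gamma0_rel_def Gamma0_def by auto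
    have "e * x' + (- b) * y' = (a * e - b * c) * x" "(- c) * x' + a * y' = (a * e - b * c) * y"
      unfolding G(3,4) by (simp_all add: algebra_simps)
    then have "x = e * x' + (- b) * y'" "y = (- c) * x' + a * y'" using G(1) by simp_all
    moreover have "(e, - b, - c, a) \<in> Gamma0 N"
      using G by (simp add: Gamma0_def mult.commute)
    ultimately show "(w, v) \<in> Gamma0_rel N"
      using vw unfolding Gamma0_rel_def by blast
  qed
  show "trans (Gamma0_rel N)"
  proof (rule transI)
    fix u v w assume "(u, v) \<in> Gamma0_rel N" "(v, w) \<in> Gamma0_rel N"
    then obtain x y x' y' x'' y'' a b c e a' b' c' e' where
      uvw: "u = (x, y)" "v = (x', y')" "w = (x'', y'')"
        "u \<in> primitive_vectors" "w \<in> primitive_vectors"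
      and G: "a * e - b * c = 1" "int N dvd c" "x' = a * x + b * y" "y' = c * x + e * y"
      and G': "a' * e' - b' * c' = 1" "int N dvd c'" "x'' = a' * x' + b' * y'" "y'' = c' * x' + e' * y'"
      unfolding Gamma0_rel_def Gamma0_def by auto
    have "(a' * a + b' * c) * (c' * b + e' * e) - (a' * b + b' * e) * (c' * a + e' * c)
        = (a * e - b * c) * (a' * e' - b' * c')"
      by (simp add: algebra_simps)
    then have "(a' * a + b' * c, a' * b + b' * e, c' * a + e' * c, c' * b + e' * e) \<in> Gamma0 N"
      using G(1,2) G'(1,2) by (simp add: Gamma0_def)
    moreover have "x'' = (a' * a + b' * c) * x + (a' * b + b' * e) * y"
      "y'' = (c' * a + e' * c) * x + (c' * b + e' * e) * y"
      unfolding G'(3,4) G(3,4) by (simp_all add: algebra_simps)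
    ultimately show "(u, w) \<in> Gamma0_rel N"
      using uvw unfolding Gamma0_rel_def by blast
  qed
qed

lemma cusps_of_level_eq:
  "cusps_of_level N d = (\<lambda>x. Gamma0_rel N `` {(x, int d)}) ` {x. coprime x (int d)}"
proof -
  have "\<kappa> = Gamma0_rel N `` {v}" if "\<kappa> \<in> cusps N" "v \<in> \<kappa>" for \<kappa> v
    using that equiv_Gamma0_rel[of N] unfolding cusps_def
    by (metis Image_singleton_iff equiv_class_eq quotientE)
  moreover have "Gamma0_rel N `` {v} \<in> cusps N" "v \<in> Gamma0_rel N `` {v}"
    if "v \<in> primitive_vectors" for v
    using that equiv_class_self[OF equiv_Gamma0_rel] unfolding cusps_def
    by (auto intro: quotientI)
  moreover have "(x, int d) \<in> primitive_vectors \<longleftrightarrow> coprime x (int d)" for x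
    by (simp add: primitive_vectors_def)
  ultimately show ?thesis
    unfolding cusps_of_level_def by blast
qed

lemma finite_cusps_of_level:
  assumes "d > 0"
  shows "finite (cusps_of_level N d)"
proof -
  have "cusps_of_level N d \<subseteq> (\<lambda>x. Gamma0_rel N `` {(x, int d)}) ` {0..<int d}"
  proof
    fix \<kappa> assume "\<kappa> \<in> cusps_of_level N d"
    then obtain x where x: "coprime x (int d)" "\<kappa> = Gamma0_rel N `` {(x, int d)}"
      unfolding cusps_of_level_eq by blast
    have "(1, - (x div int d), 0, 1) \<in> Gamma0 N" by (simp add: Gamma0_def)
    moreover have "x mod int d = 1 * x + - (x div int d) * int d"
      by (simp add: minus_div_mult_eq_mod [symmetric])
    moreover have "int d = 0 * x + 1 * int d" by simp
    moreover have "coprime (x mod int d) (int d)" using x(1) assms by simp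
    ultimately have "((x, int d), (x mod int d, int d)) \<in> Gamma0_rel N"
      using x(1) unfolding Gamma0_rel_def primitive_vectors_def by blast
    then have "\<kappa> = Gamma0_rel N `` {(x mod int d, int d)}"
      unfolding x(2) by (rule equiv_class_eq[OF equiv_Gamma0_rel])
    then show "\<kappa> \<in> (\<lambda>x. Gamma0_rel N `` {(x, int d)}) ` {0..<int d}"
      using assms by auto
  qed
  then show ?thesis by (rule finite_subset) simp
qed

lemma Gamma0_rel_dvd:
  assumes "((x, int d), (x', int d')) \<in> Gamma0_rel N" "d dvd N"
  shows "d dvd d'"
proof -
  from assms(1) obtain c e where "int N dvd c" "int d' = c * x + e * int d"
    unfolding Gamma0_rel_def Gamma0_def by auto
  then show ?thesis using assms(2)
    by (metis dvd_add dvd_mult2 dvd_trans dvd_triv_right int_dvd_int_iff)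
qed

lemma mem_cusps_of_level_iff:
  assumes "d dvd N" "d' dvd N"
  shows "Gamma0_rel N `` {(1, int d')} \<in> cusps_of_level N d \<longleftrightarrow> d = d'"
proof
  assume "Gamma0_rel N `` {(1, int d')} \<in> cusps_of_level N d"
  then obtain x where x: "coprime x (int d)"
    "Gamma0_rel N `` {(1, int d')} = Gamma0_rel N `` {(x, int d)}"
    unfolding cusps_of_level_eq by blast
  then have R: "((1, int d'), (x, int d)) \<in> Gamma0_rel N"
    using eq_equiv_class[OF x(2) equiv_Gamma0_rel] by (simp add: primitive_vectors_def)
  then have "((x, int d), (1, int d')) \<in> Gamma0_rel N"
    using equiv_Gamma0_rel[of N] by (meson equivE symD)
  then show "d = d'" using R assms Gamma0_rel_dvd by (meson dvd_antisym)
qed (auto simp: cusps_of_level_eq)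

lemma lookup_level_sum:
  assumes "N > 0" "d' dvd N"
  shows "Poly_Mapping.lookup (\<Sum>d | d dvd N. frag_cmul (a d) (P_div N d)) (Gamma0_rel N `` {(1, int d')})
         = a d'"
proof -
  have P: "Poly_Mapping.lookup (P_div N d) (Gamma0_rel N `` {(1, int d')}) = (if d = d' then 1 else 0)"
    if d: "d dvd N" for d
  proof -
    have "finite (cusps_of_level N d)"
      using d assms by (intro finite_cusps_of_level) (auto intro: dvd_pos_nat)
    then show ?thesis
      using mem_cusps_of_level_iff[OF d assms(2)]
      unfolding P_div_def lookup_sum by (simp add: sum.delta)
  qed
  have "Poly_Mapping.lookup (\<Sum>d | d dvd N. frag_cmul (a d) (P_div N d)) (Gamma0_rel N `` {(1, int d')})
      = (\<Sum>d | d dvd N. if d = d' then a d else 0)"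
    unfolding lookup_sum by (intro sum.cong) (auto simp: P)
  then show ?thesis using assms by (simp add: sum.delta')
qed

lemma level_coeffs_eqI:
  assumes "N > 0" "\<And>d. \<not> d dvd N \<Longrightarrow> a d = 0" "C = (\<Sum>d | d dvd N. frag_cmul (a d) (P_div N d))"
  shows "level_coeffs N C = a"
  unfolding level_coeffs_def
proof (rule the_equality)
  fix b assume b: "(\<forall>d. \<not> d dvd N \<longrightarrow> b d = 0) \<and> C = (\<Sum>d | d dvd N. frag_cmul (b d) (P_div N d))"
  show "b = a"
  proof
    fix d show "b d = a d"
      using lookup_level_sum[OF assms(1), of d a] lookup_level_sum[OF assms(1), of d b] b assms(2,3)
      by (cases "d dvd N") simp_all
  qed
qed (use assms in auto)

end

theory Submission
  imports Defs "HOL-Library.FuncSet"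
begin

text \<open>
  The vector \<open>V(C\<^sub>d)\<close> is a difference of two pure tensors over the primes dividing \<open>N\<close>. For
  \<open>z = gcd(d, N/d)\<close>, every prime power \<open>p\<^sup>k\<close> exactly dividing \<open>z\<close> contributes a common factor \<open>p\<^bsup>k-1\<^esup>\<close>, which gives
  \<open>z / rad z\<close>. The gcd of the remaining vector is computed by removing one prime \<open>p\<close> at a time,
  where \<open>r\<close> and \<open>f\<close> are the valuations of \<open>N\<close> and \<open>d\<close>: the gcd is unchanged if \<open>f = 0\<close>; it is \<open>1\<close> if
  \<open>f = r \<ge> 3\<close> or \<open>2 \<le> f < r\<close>; it becomes \<open>gcd(p, _)\<close> if \<open>f = r = 2\<close> or \<open>f = 1 < r\<close>; and if only primes
  with \<open>f = r = 1\<close> are left, it is the gcd of the squarefree case.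

  In \<open>Pw\<^sub>p\<close> the sums over divisors factor as well. At each prime the two columns have the same sum
  \<open>q - 1\<close> or \<open>(q - 1)\<^sup>2\<close>, and at \<open>p\<close> their sums over odd exponents differ by a multiple of \<open>p + 1\<close>. So
  \<open>Pw\<^sub>p\<close> times the remaining gcd is \<open>c (p + 1)\<close> times a product of powers of the \<open>q - 1\<close> with
  \<open>c \<in> {0, 1, -1, -p}\<close>, and its parity is decided by comparing powers of \<open>2\<close>.
\<close>


section \<open>The local columns and their gcd\<close>

text \<open>
  These are the columns of \<open>\<Upsilon>(p\<^sup>r)\<close> at \<open>1\<close> (multiplied by \<open>\<phi>(p\<^sup>m)\<close> for \<open>m = min(f, r - f)\<close>) and at
  \<open>p\<^sup>f\<close>, after removal of the common factor \<open>p\<^bsup>m-1\<^esup>\<close> if \<open>m > 0\<close>. They vanish in all rows \<open>e > r \<ge> 1\<close>, so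
  that below the row exponents can range over all functions.
\<close>

definition col_one :: "nat \<Rightarrow> nat \<Rightarrow> nat \<Rightarrow> nat \<Rightarrow> int" where
  "col_one p r f e = (if 0 < f \<and> f < r then int p - 1 else 1) *
     (if e = 0 then int p else if e = 1 then -1 else 0)"

definition col_d :: "nat \<Rightarrow> nat \<Rightarrow> nat \<Rightarrow> nat \<Rightarrow> int" where
  "col_d p r f e =
     (if e = f then (if f = 0 \<or> f = r then int p else (int p)\<^sup>2 + 1)
      else if e \<le> r \<and> (e = f + 1 \<or> f = e + 1) then - (if 0 < f \<and> f < r then int p else 1)
      else 0)"

text \<open>Up to the factor \<open>z / rad z\<close> this is the entry of \<open>V(C_d)\<close> in
  the row of the divisor with valuations \<open>e\<close>. The set \<open>P\<close> is a parameter
  so that primes can be removed one at a time.\<close>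

definition col_diff :: "nat set \<Rightarrow> (nat \<Rightarrow> nat) \<Rightarrow> (nat \<Rightarrow> nat) \<Rightarrow> (nat \<Rightarrow> nat) \<Rightarrow> int" where
  "col_diff P r f e = (\<Prod>p\<in>P. col_one p (r p) (f p) (e p)) - (\<Prod>p\<in>P. col_d p (r p) (f p) (e p))"

definition col_gcd :: "nat set \<Rightarrow> (nat \<Rightarrow> nat) \<Rightarrow> (nat \<Rightarrow> nat) \<Rightarrow> int" where
  "col_gcd P r f = Gcd (range (col_diff P r f))"

lemma col_gcd_nonneg [simp]: "col_gcd P r f \<ge> 0"
  by (simp add: col_gcd_def)

lemma dvd_col_gcd_iff: "x dvd col_gcd P r f \<longleftrightarrow> (\<forall>e. x dvd col_diff P r f e)"
  by (simp add: col_gcd_def dvd_Gcd_iff)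

lemma col_diff_cong:
  assumes "\<And>p. p \<in> P \<Longrightarrow> r p = r' p" "\<And>p. p \<in> P \<Longrightarrow> f p = f' p" "\<And>p. p \<in> P \<Longrightarrow> e p = e' p"
  shows "col_diff P r f e = col_diff P r' f' e'"
  unfolding col_diff_def by (intro arg_cong2[where f = "(-)"] prod.cong) (simp_all add: assms)

text \<open>The row at \<open>p\<close> and the rows at the other primes vary independently, so the
  quantifier over \<open>e\<close> splits into one over \<open>i\<close> and one over the remaining
  rows. Each removal of a prime starts here.\<close>

lemma dvd_col_gcd_insert_iff:
  assumes "finite P" "p \<notin> P"
  shows "x dvd col_gcd (insert p P) r f \<longleftrightarrow>
    (\<forall>i e. x dvd col_one p (r p) (f p) i * (\<Prod>q\<in>P. col_one q (r q) (f q) (e q)) -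
                col_d p (r p) (f p) i * (\<Prod>q\<in>P. col_d q (r q) (f q) (e q)))"
    (is "_ \<longleftrightarrow> (\<forall>i e. x dvd ?E i e)")
proof -
  have "col_diff (insert p P) r f (e(p := i)) = ?E i e" for i e
  proof -
    have "(\<Prod>q\<in>P. g q ((e(p := i)) q)) = (\<Prod>q\<in>P. g q (e q))" for g :: "nat \<Rightarrow> nat \<Rightarrow> int"
      using assms by (intro prod.cong) auto
    from this[of "\<lambda>q. col_one q (r q) (f q)"] this[of "\<lambda>q. col_d q (r q) (f q)"] show ?thesis
      using assms by (simp add: col_diff_def)
  qed
  moreover have "col_diff (insert p P) r f e = ?E (e p) e" for e
    using assms by (simp add: col_diff_def)
  ultimately show ?thesis
    unfolding dvd_col_gcd_iff by metis
qed

lemma col_gcd_empty [simp]: "col_gcd {} r f = 0"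
  by (simp add: col_gcd_def col_diff_def)

section \<open>Removing one prime from the gcd\<close>

lemma int_eqI_dvd:
  fixes a b :: int
  assumes "a \<ge> 0" "b \<ge> 0" "\<And>x. x dvd a \<longleftrightarrow> x dvd b"
  shows "a = b"
  using zdvd_antisym_nonneg[OF assms(1,2)] assms(3)[of a] assms(3)[of b] by simp

text \<open>For \<open>f p = 0\<close> the two columns at \<open>p\<close> coincide, so their entry
  is a common factor of the difference. Row 1 has entry -1, so nothing is added to the gcd.\<close>

lemma col_gcd_insert_level_zero:
  assumes "finite P" "p \<notin> P" "r p \<ge> 1" "f p = 0"
  shows "col_gcd (insert p P) r f = col_gcd P r f"
proof (rule int_eqI_dvd)
  have eq: "col_d p (r p) (f p) i = col_one p (r p) 0 i" for i
    using assms(3,4) by (auto simp: col_one_def col_d_def)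
  have E: "col_one p (r p) (f p) i * (\<Prod>q\<in>P. col_one q (r q) (f q) (e q)) -
      col_d p (r p) (f p) i * (\<Prod>q\<in>P. col_d q (r q) (f q) (e q))
    = col_one p (r p) 0 i * col_diff P r f e" for i e
    unfolding eq by (simp add: assms(4) col_diff_def right_diff_distrib)
  show "x dvd col_gcd (insert p P) r f \<longleftrightarrow> x dvd col_gcd P r f" for x
    unfolding dvd_col_gcd_insert_iff[OF assms(1,2)] dvd_col_gcd_iff[of x P] E
  proof safe
    fix e assume "\<forall>i e. x dvd col_one p (r p) 0 i * col_diff P r f e"
    from this[rule_format, of 1 e] show "x dvd col_diff P r f e"
      by (simp add: col_one_def)
  qed (rule dvd_mult, blast)
qed simp_all

lemma col_gcd_level_zero:
  assumes "finite P" "finite Q" "P \<inter> Q = {}" "\<And>p. p \<in> Q \<Longrightarrow> r p \<ge> 1" "\<And>p. p \<in> Q \<Longrightarrow> f p = 0"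
  shows "col_gcd (P \<union> Q) r f = col_gcd P r f"
  using assms(2,1,3-5)
proof (induction Q rule: finite_induct)
  case (insert q Q)
  then show ?case
    using col_gcd_insert_level_zero[of "P \<union> Q" q r f] by simp
qed simp

text \<open>The entries of the column at \<open>p^f\<close> have gcd 1: an end column contains -1
  next to the diagonal, and an inner one contains the coprime entries \<open>p^2 + 1\<close> and
  \<open>-p\<close>.\<close>

lemma dvd_of_dvd_mult_col_d:
  assumes "f \<le> r" "\<And>i. x dvd col_d p r f i * y" "1 \<le> r"
  shows "x dvd y"
proof -
  consider "f = 0" | "f = r" | "0 < f" "f < r"
    using assms(1) by linarith
  then show ?thesis
  proof cases
    case 1
    then show ?thesis using assms(2)[of 1] assms(3) by (simp add: col_d_def)
  next
    case 2
    then show ?thesis using assms(2)[of "r - 1"] assms(3) by (auto simp: col_d_def split: if_splits)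
  next
    case 3
    then have "x dvd ((int p)\<^sup>2 + 1) * y" "x dvd int p * y"
      using assms(2)[of f] assms(2)[of "f + 1"] by (simp_all add: col_d_def)
    moreover have "y = ((int p)\<^sup>2 + 1) * y - int p * (int p * y)"
      by (simp add: algebra_simps power2_eq_square)
    ultimately show ?thesis by (metis dvd_diff dvd_mult)
  qed
qed

text \<open>The gcd 1 of the local columns passes to their tensor product. In the induction the
  entry at the new prime is absorbed into \<open>y\<close>, which is why \<open>y\<close> is
  arbitrary.\<close>

lemma dvd_of_dvd_mult_prod_col_d:
  assumes "finite P" "\<And>q. q \<in> P \<Longrightarrow> f q \<le> r q" "\<And>q. q \<in> P \<Longrightarrow> 1 \<le> r q"
    "\<And>e. x dvd y * (\<Prod>q\<in>P. col_d q (r q) (f q) (e q))"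
  shows "x dvd y"
  using assms
proof (induction P arbitrary: y rule: finite_induct)
  case (insert p P)
  have "x dvd (col_d p (r p) (f p) i * y) * (\<Prod>q\<in>P. col_d q (r q) (f q) (e q))" for i e
  proof -
    have "(\<Prod>q\<in>P. col_d q (r q) (f q) ((e(p := i)) q)) = (\<Prod>q\<in>P. col_d q (r q) (f q) (e q))"
      using insert.hyps by (intro prod.cong) auto
    then show ?thesis
      using insert.prems(3)[of "e(p := i)"] insert.hyps by (simp add: mult_ac)
  qed
  then have "x dvd col_d p (r p) (f p) i * y" for i
    by (rule insert.IH[rotated 2]) (use insert.prems in auto)
  then show ?case
    by (rule dvd_of_dvd_mult_col_d[rotated]) (use insert.prems in auto)
qed simp

text \<open>
  At \<open>p\<close> there are two rows in which the first column vanishes while the entries of the second one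
  are coprime.
\<close>

lemma col_gcd_insert_trivial:
  assumes "finite P" "p \<notin> P" "\<And>q. q \<in> insert p P \<Longrightarrow> f q \<le> r q" "\<And>q. q \<in> insert p P \<Longrightarrow> 1 \<le> r q"
    and "f p = r p \<and> r p \<ge> 3 \<or> 2 \<le> f p \<and> f p < r p"
  shows "col_gcd (insert p P) r f = 1"
proof -
  let ?x = "col_gcd (insert p P) r f"
  let ?A = "\<lambda>e. \<Prod>q\<in>P. col_one q (r q) (f q) (e q)"
  let ?B = "\<lambda>e. \<Prod>q\<in>P. col_d q (r q) (f q) (e q)"
  have *: "?x dvd col_one p (r p) (f p) i * ?A e - col_d p (r p) (f p) i * ?B e" for i e
    by (rule iffD1[OF dvd_col_gcd_insert_iff[OF assms(1,2)] dvd_refl, rule_format])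
  have "?x dvd ?B e" for e
    using assms(5)
  proof
    assume "f p = r p \<and> r p \<ge> 3"
    then show ?thesis
      using *[of "r p - 1" e] by (auto simp: col_d_def col_one_def split: if_splits)
  next
    assume f: "2 \<le> f p \<and> f p < r p"
    then have "?x dvd ((int p)\<^sup>2 + 1) * ?B e" "?x dvd int p * ?B e"
      using *[of "f p" e] *[of "f p + 1" e] by (simp_all add: col_d_def col_one_def)
    moreover have "?B e = ((int p)\<^sup>2 + 1) * ?B e - int p * (int p * ?B e)"
      by (simp add: algebra_simps power2_eq_square)
    ultimately show ?thesis by (metis dvd_diff dvd_mult)
  qed
  then have "?x dvd 1"
    using dvd_of_dvd_mult_prod_col_d[of P f r ?x 1] assms by simp
  then show ?thesis
    using col_gcd_nonneg[of "insert p P" r f] by (simp add: zdvd1_eq)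
qed

text \<open>In both cases row 2 is \<open>p\<close> times the second product up to sign, which
  forces \<open>x\<close> to divide \<open>p\<close>. Modulo \<open>p\<close>, row 1 is the
  difference of the two products up to sign, and all other rows vanish.\<close>

lemma col_gcd_insert_prime:
  assumes "finite P" "p \<notin> P" "\<And>q. q \<in> insert p P \<Longrightarrow> f q \<le> r q" "\<And>q. q \<in> insert p P \<Longrightarrow> 1 \<le> r q"
    and "f p = 2 \<and> r p = 2 \<or> f p = 1 \<and> 1 < r p"
  shows "col_gcd (insert p P) r f = gcd (int p) (col_gcd P r f)"
proof (rule int_eqI_dvd)
  fix x :: int
  let ?A = "\<lambda>e. \<Prod>q\<in>P. col_one q (r q) (f q) (e q)"
  let ?B = "\<lambda>e. \<Prod>q\<in>P. col_d q (r q) (f q) (e q)"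
  let ?E = "\<lambda>i e. col_one p (r p) (f p) i * ?A e - col_d p (r p) (f p) i * ?B e"
  have p_dvd: "x dvd int p" if "\<And>e. x dvd int p * ?B e"
    by (rule dvd_of_dvd_mult_prod_col_d[OF assms(1) _ _ that]) (use assms in auto)
  have "(\<forall>i e. x dvd ?E i e) \<longleftrightarrow> x dvd int p \<and> (\<forall>e. x dvd ?A e - ?B e)"
    using assms(5)
  proof
    assume f: "f p = 2 \<and> r p = 2"
    have E: "?E i e = (if i = 0 then int p * ?A e else if i = 1 then - (?A e - ?B e)
        else if i = 2 then - (int p * ?B e) else 0)" for i e
      using f by (simp add: col_one_def col_d_def)
    show ?thesis
    proof (intro iffI conjI allI)
      assume *: "\<forall>i e. x dvd ?E i e"
      have "x dvd int p * ?B e" for e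
        using *[rule_format, of 2 e] unfolding E by simp
      then show "x dvd int p"
        by (rule p_dvd)
      show "x dvd ?A e - ?B e" for e
        using *[rule_format, of 1 e] unfolding E by (simp add: dvd_diff_commute)
    next
      show "x dvd ?E i e" if "x dvd int p \<and> (\<forall>e. x dvd ?A e - ?B e)" for i e
        unfolding E using that by (auto simp del: minus_diff_eq)
    qed
  next
    assume f: "f p = 1 \<and> 1 < r p"
    have E: "?E i e = (if i = 0 then int p * ((int p - 1) * ?A e + ?B e)
        else if i = 1 then (?A e - ?B e) - int p * (?A e + int p * ?B e)
        else if i = 2 then int p * ?B e else 0)" for i e
      using f by (simp add: col_one_def col_d_def power2_eq_square algebra_simps)
    show ?thesis
    proof (intro iffI conjI allI)
      assume *: "\<forall>i e. x dvd ?E i e"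
      have "x dvd int p * ?B e" for e
        using *[rule_format, of 2 e] unfolding E by simp
      then show p: "x dvd int p"
        by (rule p_dvd)
      show "x dvd ?A e - ?B e" for e
        using *[rule_format, of 1 e] dvd_mult2[OF p] unfolding E
        by (simp add: dvd_diff_left_iff)
    next
      show "x dvd ?E i e" if "x dvd int p \<and> (\<forall>e. x dvd ?A e - ?B e)" for i e
        unfolding E using that by auto
    qed
  qed
  then show "x dvd col_gcd (insert p P) r f \<longleftrightarrow> x dvd gcd (int p) (col_gcd P r f)"
    by (simp only: dvd_col_gcd_insert_iff[OF assms(1,2)] gcd_greatest_iff dvd_col_gcd_iff[of x P] col_diff_def)
qed simp_all

lemma col_gcd_trivial:
  assumes "finite P" "\<And>q. q \<in> P \<Longrightarrow> f q \<le> r q" "\<And>q. q \<in> P \<Longrightarrow> 1 \<le> r q"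
    and "p \<in> P" "f p = r p \<and> r p \<ge> 3 \<or> 2 \<le> f p \<and> f p < r p"
  shows "col_gcd P r f = 1"
  using col_gcd_insert_trivial[of "P - {p}" p f r, unfolded insert_Diff[OF assms(4)]] assms by blast

lemma col_gcd_prime:
  assumes "finite P" "\<And>q. q \<in> P \<Longrightarrow> f q \<le> r q" "\<And>q. q \<in> P \<Longrightarrow> 1 \<le> r q"
    and "p \<in> P" "f p = 2 \<and> r p = 2 \<or> f p = 1 \<and> 1 < r p"
  shows "col_gcd P r f = gcd (int p) (col_gcd (P - {p}) r f)"
  using col_gcd_insert_prime[of "P - {p}" p f r, unfolded insert_Diff[OF assms(4)]] assms by blast

text \<open>Removing \<open>p\<close> and \<open>q\<close> in turn shows that the gcd divides two
  coprime integers.\<close>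

lemma col_gcd_two_primes:
  assumes "finite P" "\<And>q. q \<in> P \<Longrightarrow> f q \<le> r q" "\<And>q. q \<in> P \<Longrightarrow> 1 \<le> r q"
    and "p \<in> P" "f p = 2 \<and> r p = 2 \<or> f p = 1 \<and> 1 < r p"
    and "q \<in> P" "f q = 2 \<and> r q = 2 \<or> f q = 1 \<and> 1 < r q"
    and "prime p" "prime q" "p \<noteq> q"
  shows "col_gcd P r f = 1"
proof -
  have "col_gcd P r f = gcd (int p) (gcd (int q) (col_gcd (P - {p} - {q}) r f))"
    using col_gcd_prime[of P f r p] col_gcd_prime[of "P - {p}" f r q] assms by simp
  moreover have "coprime (int p) (int q)"
    using assms by (simp add: primes_coprime)
  ultimately show ?thesis
    by (simp add: gcd.assoc[symmetric])
qed

text \<open>The zero row is the first generator, and the rows with a single exponent 1 yield the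
  \<open>p^2 - 1\<close>. Conversely a common divisor of the generators is coprime to every prime in
  \<open>P\<close>, so a row may be multiplied by primes before it is compared with the
  generators.\<close>

lemma col_gcd_squarefree:
  assumes "finite P" "\<And>p. p \<in> P \<Longrightarrow> prime p \<and> f p = 1 \<and> r p = 1" "P \<noteq> {}"
  shows "col_gcd P r f = Gcd (insert (int (\<Prod>P) + (- 1) ^ (card P - 1)) ((\<lambda>p. (int p)\<^sup>2 - 1) ` P))"
    (is "_ = Gcd (insert ?s ?Q)")
proof (rule int_eqI_dvd)
  fix x :: int
  have A: "(\<Prod>p\<in>P. col_one p (r p) (f p) (e p)) = (\<Prod>p\<in>P. if e p = 0 then int p else if e p = 1 then -1 else 0)" for e
    using assms(2) by (intro prod.cong) (auto simp: col_one_def)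
  have B: "(\<Prod>p\<in>P. col_d p (r p) (f p) (e p)) = (\<Prod>p\<in>P. if e p = 0 then -1 else if e p = 1 then int p else 0)" for e
    using assms(2) by (intro prod.cong) (auto simp: col_d_def)
  have card: "card P = Suc (card P - 1)"
    using assms(1,3) by (simp add: card_gt_0_iff)
  then have sgn: "(- 1 :: int) ^ (card P - 1) = - ((- 1) ^ card P)"
    by (metis mult_minus1 power_Suc minus_minus)
  have s: "col_diff P r f (\<lambda>_. 0) = ?s"
    unfolding col_diff_def A B sgn by simp
  \<comment> \<open>Multiplying by \<open>p\<close> completes the first product to the product over
    all of \<open>P\<close>, which then cancels against \<open>?s\<close>.\<close>
  have t: "?s + int p * col_diff P r f (\<lambda>q. if q = p then 1 else 0)
         = (- 1) ^ (card P - 1) * (1 - (int p)\<^sup>2)" if "p \<in> P" for p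
  proof -
    have rem: "(\<Prod>q\<in>P. g q) = g p * (\<Prod>q\<in>P - {p}. g q)" for g :: "nat \<Rightarrow> int"
      using prod.remove[OF assms(1) that] .
    have "(\<Prod>q\<in>P - {p}. if (if q = p then 1 else (0::nat)) = 0 then int q
        else if (if q = p then 1 else (0::nat)) = 1 then - 1 else 0) = (\<Prod>q\<in>P - {p}. int q)"
      by (intro prod.cong) auto
    moreover have "(\<Prod>q\<in>P - {p}. if (if q = p then 1 else (0::nat)) = 0 then - 1
        else if (if q = p then 1 else (0::nat)) = 1 then int q else 0) = (\<Prod>q\<in>P - {p}. - 1)"
      by (intro prod.cong) auto
    moreover have "(\<Prod>q\<in>P - {p}. - 1 :: int) = (- 1) ^ (card P - 1)"
      using that by simp
    ultimately have "col_diff P r f (\<lambda>q. if q = p then 1 else 0)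
        = - (\<Prod>q\<in>P - {p}. int q) - int p * (- 1) ^ (card P - 1)"
      unfolding col_diff_def A B rem by simp
    moreover have "int (\<Prod>P) = int p * (\<Prod>q\<in>P - {p}. int q)"
      by (simp add: rem)
    ultimately show ?thesis
      by (simp only:) (simp add: algebra_simps power2_eq_square)
  qed
  show "x dvd col_gcd P r f \<longleftrightarrow> x dvd Gcd (insert ?s ?Q)"
  proof
    assume "x dvd col_gcd P r f"
    then have *: "x dvd col_diff P r f e" for e
      by (simp add: dvd_col_gcd_iff)
    have "x dvd (int p)\<^sup>2 - 1" if "p \<in> P" for p
    proof -
      have "x dvd (- 1) ^ (card P - 1) * (1 - (int p)\<^sup>2)"
        unfolding t[OF that, symmetric] using * s by (metis dvd_add dvd_mult)
      then have "x dvd 1 - (int p)\<^sup>2"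
        by (metis dvd_mult dvd_mult_left left_minus_one_mult_self mult.assoc mult.left_commute mult_1)
      then show ?thesis by (simp add: dvd_diff_commute)
    qed
    then show "x dvd Gcd (insert ?s ?Q)"
      using * s by (auto intro!: Gcd_greatest simp del: Gcd_insert) metis
  next
    assume "x dvd Gcd (insert ?s ?Q)"
    then have all: "\<forall>y\<in>insert ?s ?Q. x dvd y"
      unfolding dvd_Gcd_iff .
    then have xs: "x dvd ?s"
      by blast
    have xq: "x dvd (int p)\<^sup>2 - 1" if "p \<in> P" for p
      using all that by blast
    \<comment> \<open>A common divisor of \<open>x\<close> and \<open>p\<close> divides both
      \<open>p^2\<close> and \<open>p^2 - 1\<close>.\<close>
    have cop: "coprime x (int p)" if "p \<in> P" for p
    proof (rule coprimeI)
      fix y assume "y dvd x" "y dvd int p"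
      then have "y dvd (int p)\<^sup>2 - 1" "y dvd (int p)\<^sup>2"
        using xq[OF that] by (auto simp: power2_eq_square intro: dvd_trans)
      then show "is_unit y"
        by (metis dvd_diff_right_iff)
    qed
    have "x dvd col_diff P r f e" for e
    proof (cases "\<forall>p\<in>P. e p \<le> 1")
      \<comment> \<open>A row with an exponent above 1 is zero in both columns.\<close>
      case False
      then obtain p where "p \<in> P" "e p \<noteq> 0" "e p \<noteq> 1" by force
      then have "col_diff P r f e = 0"
        unfolding col_diff_def A B using assms(1)
        by (subst (1 2) prod_zero) (auto intro!: bexI[of _ p])
      then show ?thesis by simp
    next
      case True
      define S where "S = {p\<in>P. e p = 1}"
      have S: "S \<subseteq> P" "finite S" "P = (P - S) \<union> S"
        using assms(1) by (auto simp: S_def)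
      have split: "(\<Prod>p\<in>P. g p) = (\<Prod>p\<in>P - S. g p) * (\<Prod>p\<in>S. g p)" for g :: "nat \<Rightarrow> int"
        using prod.subset_diff[OF S(1) assms(1)] .
      have not_S: "e p = 0" if "p \<in> P - S" for p
        using that True by (force simp: S_def)
      have in_S: "e p = 1" if "p \<in> S" for p
        using that by (simp add: S_def)
      have a: "(\<Prod>p\<in>P. col_one p (r p) (f p) (e p)) = (\<Prod>p\<in>P - S. int p) * (- 1) ^ card S"
      proof -
        have "(\<Prod>p\<in>P - S. if e p = 0 then int p else if e p = 1 then -1 else 0) = (\<Prod>p\<in>P - S. int p)"
          by (rule prod.cong) (simp_all only: not_S refl if_True)
        moreover have "(\<Prod>p\<in>S. if e p = 0 then int p else if e p = 1 then -1 else 0) = (\<Prod>p\<in>S. - 1)"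
          by (rule prod.cong) (simp_all add: in_S)
        ultimately show ?thesis
          unfolding A split by simp
      qed
      have b: "(\<Prod>p\<in>P. col_d p (r p) (f p) (e p)) = (- 1) ^ card (P - S) * (\<Prod>p\<in>S. int p)"
      proof -
        have "(\<Prod>p\<in>P - S. if e p = 0 then -1 else if e p = 1 then int p else 0) = (\<Prod>p\<in>P - S. - 1)"
          by (rule prod.cong) (simp_all only: not_S refl if_True)
        moreover have "(\<Prod>p\<in>S. if e p = 0 then -1 else if e p = 1 then int p else 0) = (\<Prod>p\<in>S. int p)"
          by (rule prod.cong) (simp_all add: in_S)
        ultimately show ?thesis
          unfolding B split by simp
      qed
      have pp: "int (\<Prod>P) = (\<Prod>p\<in>P - S. int p) * (\<Prod>p\<in>S. int p)"
        unfolding of_nat_prod by (rule split)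
      have cc: "card P = card (P - S) + card S"
        using S(1) assms(1) by (simp add: card_Diff_subset card_mono finite_subset)
      have sq: "x dvd (\<Prod>p\<in>S. int p)\<^sup>2 - 1"
        using S(2,1)
      proof (induction S rule: finite_induct)
        case (insert p S)
        let ?R = "\<Prod>p\<in>S. int p"
        have "(\<Prod>p\<in>insert p S. int p)\<^sup>2 - 1 = (int p)\<^sup>2 * (?R\<^sup>2 - 1) + ((int p)\<^sup>2 - 1)"
          using insert.hyps by (simp add: algebra_simps power_mult_distrib)
        moreover have "x dvd (int p)\<^sup>2 * (?R\<^sup>2 - 1) + ((int p)\<^sup>2 - 1)"
          using insert xq[of p] by (intro dvd_add dvd_mult) auto
        ultimately show ?case by (simp only:)
      qed simp
      let ?R = "\<Prod>p\<in>S. int p"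
      \<comment> \<open>Multiplication by \<open>?R\<close> turns the first product into a signed
        product over all of \<open>P\<close> and the second into a signed \<open>?R^2\<close>, which
        is 1 modulo \<open>x\<close> by \<open>sq\<close>. Afterwards \<open>?R\<close> is cancelled
        as coprime to \<open>x\<close>.\<close>
      have "?R * col_diff P r f e = (- 1) ^ card S * ?s - (- 1) ^ card (P - S) * (?R\<^sup>2 - 1)"
      proof -
        have "(- 1 :: int) ^ card S * (- 1) ^ card P = ((- 1) ^ card S * (- 1) ^ card S) * (- 1) ^ card (P - S)"
          unfolding cc power_add by (simp only: mult_ac)
        then have "(- 1 :: int) ^ card S * (- 1) ^ card P = (- 1) ^ card (P - S)"
          by (simp add: left_minus_one_mult_self)
        then have "(- 1 :: int) ^ card S * ?s = (- 1) ^ card S * int (\<Prod>P) - (- 1) ^ card (P - S)"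
          unfolding sgn by (simp add: right_diff_distrib del: of_nat_prod)
        then show ?thesis
          unfolding col_diff_def a b pp by (simp add: algebra_simps power2_eq_square)
      qed
      moreover have "x dvd (- 1) ^ card S * ?s - (- 1) ^ card (P - S) * (?R\<^sup>2 - 1)"
        by (intro dvd_diff dvd_mult[OF xs] dvd_mult[OF sq])
      moreover have "coprime x ?R"
        using cop S(1) by (intro prod_coprime_right) auto
      ultimately show ?thesis
        using coprime_dvd_mult_right_iff[of x ?R "col_diff P r f e"] by (simp only:)
    qed
    then show "x dvd col_gcd P r f"
      by (simp add: dvd_col_gcd_iff)
  qed
qed (simp, rule Gcd_int_greater_eq_0)


section \<open>Factorisation over the primes\<close>

text \<open>The definite description in \<open>level_coeffs\<close> is resolved by
  \<open>level_coeffs_eqI\<close> with explicit coefficients; \<open>d\<close> being different from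
  1 keeps the two nonzero positions apart.\<close>

lemma V_div_C_div:
  assumes "N > 0" "d dvd N" "d \<noteq> 1"
  shows "V_div N (C_div N d) \<delta> =
    int (totient (gcd d (N div d))) * Upsilon N \<delta> 1 - Upsilon N \<delta> d"
proof -
  let ?t = "int (totient (gcd d (N div d)))"
  define a where "a = (\<lambda>x. if x = 1 then ?t else if x = d then -1 else 0)"
  have sum: "(\<Sum>x | x dvd N. g x) = g 1 + g d" if "\<And>x. x \<noteq> 1 \<Longrightarrow> x \<noteq> d \<Longrightarrow> g x = 0"
    for g :: "nat \<Rightarrow> 'a :: comm_monoid_add"
  proof -
    have "(\<Sum>x | x dvd N. g x) = sum g {1, d}"
      using assms that by (intro sum.mono_neutral_right) auto
    then show ?thesis using assms(3) by simp
  qed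
  have "level_coeffs N (C_div N d) = a"
  proof (rule level_coeffs_eqI[OF assms(1)])
    show "C_div N d = (\<Sum>x | x dvd N. frag_cmul (a x) (P_div N x))"
      by (subst sum) (use assms in \<open>simp_all add: a_def C_div_def\<close>)
  qed (use assms in \<open>auto simp: a_def\<close>)
  then show ?thesis
    unfolding V_div_def by (simp, subst sum) (use assms in \<open>simp_all add: a_def\<close>)
qed

text \<open>For \<open>m = min(f, r - f) > 0\<close> the totient is
  \<open>p^(m-1) * (p - 1)\<close>. For \<open>m = 0\<close> it is 1, and truncated subtraction
  makes the extracted power 1 as well.\<close>

lemma Upsilon_pp_one:
  assumes "prime p" "1 \<le> r" "f \<le> r"
  shows "int (totient (p ^ min f (r - f))) * Upsilon_pp p r e 0 =
    int (p ^ (min f (r - f) - 1)) * col_one p r f e"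
proof -
  have "int (totient (p ^ min f (r - f))) =
      int (p ^ (min f (r - f) - 1)) * (if 0 < f \<and> f < r then int p - 1 else 1)"
    using assms prime_ge_1_nat[OF assms(1)] by (auto simp: totient_prime_power of_nat_diff)
  then show ?thesis
    using assms by (auto simp: Upsilon_pp_def col_one_def Let_def)
qed

text \<open>The bound on \<open>e\<close> matters: in row \<open>r + 1\<close> and column
  \<open>r\<close> the formula \<open>Upsilon_pp\<close> gives -1, while \<open>col_d\<close> is
  0.\<close>

lemma Upsilon_pp_col_d:
  assumes "1 \<le> r" "f \<le> r" "e \<le> r"
  shows "Upsilon_pp p r e f = int (p ^ (min f (r - f) - 1)) * col_d p r f e"
proof (cases "0 < f \<and> f < r")
  case True
  then have "min f (r - f) = Suc (min f (r - f) - 1)" by auto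
  then have "int p ^ min f (r - f) = int p ^ (min f (r - f) - 1) * int p"
    by (metis power_Suc2)
  with True show ?thesis
    using assms by (simp add: Upsilon_pp_def col_d_def Let_def)
next
  case False
  then have "min f (r - f) = 0" using assms by auto
  with False show ?thesis
    using assms by (auto simp: Upsilon_pp_def col_d_def Let_def)
qed

context
  fixes N d :: nat
  assumes N: "N > 0" and d: "d dvd N"
begin

lemma multiplicity_le: "multiplicity p d \<le> multiplicity p N"
  using N d by (simp add: dvd_imp_multiplicity_le)

lemma multiplicity_gcd_div:
  assumes "prime p"
  shows "multiplicity p (gcd d (N div d)) = min (multiplicity p d) (multiplicity p N - multiplicity p d)"
proof -
  have nz: "d \<noteq> 0" "N div d \<noteq> 0" "N = d * (N div d)"
    using N d by auto
  then have "multiplicity p N = multiplicity p d + multiplicity p (N div d)"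
    using assms by (metis prime_elem_multiplicity_mult_distrib prime_imp_prime_elem)
  then show ?thesis
    using nz assms multiplicity_gcd[of d "N div d" p] by simp
qed

lemma gcd_div_nonzero: "gcd d (N div d) \<noteq> 0"
  using N d by auto

lemma totient_gcd_div:
  "totient (gcd d (N div d)) =
    (\<Prod>p\<in>prime_factors N. totient (p ^ min (multiplicity p d) (multiplicity p N - multiplicity p d)))"
proof -
  let ?z = "gcd d (N div d)"
  have "totient ?z = (\<Prod>p\<in>prime_factors ?z. totient (p ^ multiplicity p ?z))"
    using gcd_div_nonzero
    by (subst totient_formula1) (auto intro!: prod.cong simp: totient_prime_power prime_factors_multiplicity)
  also have "\<dots> = (\<Prod>p\<in>prime_factors N. totient (p ^ multiplicity p ?z))"
  proof (rule prod.mono_neutral_left)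
    show "prime_factors ?z \<subseteq> prime_factors N"
      using N d by (intro dvd_prime_factors) (auto intro: dvd_trans)
  qed (simp, auto simp: prime_factors_multiplicity)
  also have "\<dots> = (\<Prod>p\<in>prime_factors N. totient (p ^ min (multiplicity p d) (multiplicity p N - multiplicity p d)))"
    by (intro prod.cong refl) (simp add: multiplicity_gcd_div in_prime_factors_imp_prime)
  finally show ?thesis .
qed

text \<open>Dividing by \<open>rad z\<close> lowers each positive exponent by one. Truncation leaves
  exponent 0 at primes not dividing \<open>z\<close>, so the product can run over all primes of
  \<open>N\<close>.\<close>

lemma gcd_div_div_rad:
  "gcd d (N div d) div rad (gcd d (N div d)) =
    (\<Prod>p\<in>prime_factors N. p ^ (min (multiplicity p d) (multiplicity p N - multiplicity p d) - 1))"
proof -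
  let ?z = "gcd d (N div d)"
  have "?z = (\<Prod>p\<in>prime_factors ?z. p ^ multiplicity p ?z)"
    using gcd_div_nonzero by (intro prime_factorization_nat) auto
  also have "\<dots> = (\<Prod>p\<in>prime_factors ?z. p * p ^ (multiplicity p ?z - 1))"
    by (intro prod.cong) (auto simp: prime_factors_multiplicity power_Suc[symmetric] simp del: power_Suc)
  also have "\<dots> = rad ?z * (\<Prod>p\<in>prime_factors ?z. p ^ (multiplicity p ?z - 1))"
    by (simp add: prod.distrib rad_def)
  finally have "?z = rad ?z * (\<Prod>p\<in>prime_factors ?z. p ^ (multiplicity p ?z - 1))" .
  moreover have "rad ?z > 0"
    unfolding rad_def by (intro prod_pos) (auto simp: in_prime_factors_iff prime_gt_0_nat)
  ultimately have "?z div rad ?z = (\<Prod>p\<in>prime_factors ?z. p ^ (multiplicity p ?z - 1))"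
    by (metis nonzero_mult_div_cancel_left not_less_zero)
  also have "\<dots> = (\<Prod>p\<in>prime_factors N. p ^ (multiplicity p ?z - 1))"
  proof (rule prod.mono_neutral_left)
    show "prime_factors ?z \<subseteq> prime_factors N"
      using N d by (intro dvd_prime_factors) (auto intro: dvd_trans)
  qed (simp, auto simp: prime_factors_multiplicity)
  also have "\<dots> = (\<Prod>p\<in>prime_factors N. p ^ (min (multiplicity p d) (multiplicity p N - multiplicity p d) - 1))"
    by (intro prod.cong refl) (simp add: multiplicity_gcd_div in_prime_factors_imp_prime)
  finally show ?thesis .
qed

text \<open>The totient of \<open>z\<close> is distributed over the primes into the first tensor.
  Then both tensors carry the same power of each prime, and these powers multiply to
  \<open>z / rad z\<close>.\<close>

lemma V_div_eq_col_diff: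
  assumes "d \<noteq> 1" "\<delta> dvd N"
  shows "V_div N (C_div N d) \<delta> = int (gcd d (N div d) div rad (gcd d (N div d))) *
    col_diff (prime_factors N) (\<lambda>p. multiplicity p N) (\<lambda>p. multiplicity p d) (\<lambda>p. multiplicity p \<delta>)"
proof -
  let ?P = "prime_factors N"
  let ?m = "\<lambda>p. min (multiplicity p d) (multiplicity p N - multiplicity p d)"
  have P: "prime p" "1 \<le> multiplicity p N" "multiplicity p \<delta> \<le> multiplicity p N" if "p \<in> ?P" for p
    using that assms N by (auto simp: prime_factors_multiplicity dvd_imp_multiplicity_le)
  have "int (totient (gcd d (N div d))) * Upsilon N \<delta> 1 =
      (\<Prod>p\<in>?P. int (totient (p ^ ?m p)) * Upsilon_pp p (multiplicity p N) (multiplicity p \<delta>) 0)"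
    unfolding totient_gcd_div Upsilon_def by (simp add: prod.distrib)
  also have "\<dots> = (\<Prod>p\<in>?P. int (p ^ (?m p - 1)) *
      col_one p (multiplicity p N) (multiplicity p d) (multiplicity p \<delta>))"
    using P multiplicity_le by (intro prod.cong refl Upsilon_pp_one) auto
  finally have 1: "int (totient (gcd d (N div d))) * Upsilon N \<delta> 1 = \<dots>" .
  have 2: "Upsilon N \<delta> d = (\<Prod>p\<in>?P. int (p ^ (?m p - 1)) *
      col_d p (multiplicity p N) (multiplicity p d) (multiplicity p \<delta>))"
    unfolding Upsilon_def using P multiplicity_le by (intro prod.cong refl Upsilon_pp_col_d) auto
  show ?thesis
    unfolding V_div_C_div[OF N d assms(1)] 1 2 col_diff_def gcd_div_div_rad
    by (simp add: prod.distrib right_diff_distrib)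
qed

end

section \<open>Divisors of N as exponent vectors\<close>

lemma multiplicity_prod_prime_powers:
  fixes e :: "nat \<Rightarrow> nat"
  assumes "finite P" "\<And>p. p \<in> P \<Longrightarrow> prime p" "prime q"
  shows "multiplicity q (\<Prod>p\<in>P. p ^ e p) = (if q \<in> P then e q else 0)"
proof -
  have "0 \<notin> (\<lambda>p. p ^ e p) ` P"
    using assms(2) by (force dest: prime_gt_0_nat)
  then have "multiplicity q (\<Prod>p\<in>P. p ^ e p) = (\<Sum>p\<in>P. multiplicity q (p ^ e p))"
    using assms by (intro prime_elem_multiplicity_prod_distrib) auto
  also have "\<dots> = (\<Sum>p\<in>P. if q = p then e q else 0)"
    using assms by (intro sum.cong) (auto simp: multiplicity_distinct_prime_power)
  finally show ?thesis
    using assms(1) by simp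
qed

text \<open>Unique factorisation. The valuations are restricted to the primes of \<open>N\<close>
  because \<open>PiE\<close> contains only extensional functions.\<close>

lemma bij_betw_divisors_PiE:
  fixes N :: nat
  assumes "N > 0"
  shows "bij_betw (\<lambda>\<delta>. restrict (\<lambda>p. multiplicity p \<delta>) (prime_factors N)) {\<delta>. \<delta> dvd N}
    (PiE (prime_factors N) (\<lambda>p. {..multiplicity p N}))"
proof (rule bij_betw_byWitness[where f' = "\<lambda>e. \<Prod>p\<in>prime_factors N. p ^ e p"])
  let ?P = "prime_factors N"
  have P: "prime p" if "p \<in> ?P" for p
    using that by auto
  have mult: "multiplicity q (\<Prod>p\<in>?P. p ^ e p) = (if q \<in> ?P then e q else 0)" if "prime q" for q e
    using that P by (intro multiplicity_prod_prime_powers) auto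
  have nz: "(\<Prod>p\<in>?P. p ^ e p) \<noteq> 0" for e :: "nat \<Rightarrow> nat"
    using P by (auto simp: prime_gt_0_nat)
  show "\<forall>\<delta>\<in>{\<delta>. \<delta> dvd N}. (\<Prod>p\<in>?P. p ^ restrict (\<lambda>p. multiplicity p \<delta>) ?P p) = \<delta>"
  proof safe
    fix \<delta> assume \<delta>: "\<delta> dvd N"
    let ?x = "\<Prod>p\<in>?P. p ^ restrict (\<lambda>p. multiplicity p \<delta>) ?P p"
    have "\<delta> > 0" using \<delta> assms by (auto intro: dvd_pos_nat)
    have "multiplicity q \<delta> = 0" if "q \<notin> ?P" "prime q" for q
      using that \<delta> assms dvd_imp_multiplicity_le[OF \<delta>, of q] by (auto simp: prime_factors_multiplicity)
    then have "normalize ?x = normalize \<delta>"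
      using nz \<open>\<delta> > 0\<close> by (intro multiplicity_eq_imp_eq) (auto simp: mult)
    then show "?x = \<delta>" by simp
  qed
  show "\<forall>e\<in>PiE ?P (\<lambda>p. {..multiplicity p N}). restrict (\<lambda>p. multiplicity p (\<Prod>p\<in>?P. p ^ e p)) ?P = e"
    using P by (auto simp: restrict_def mult PiE_def extensional_def)
  show "(\<lambda>\<delta>. restrict (\<lambda>p. multiplicity p \<delta>) ?P) ` {\<delta>. \<delta> dvd N} \<subseteq> PiE ?P (\<lambda>p. {..multiplicity p N})"
    using assms by (auto simp: dvd_imp_multiplicity_le)
  show "(\<lambda>e. \<Prod>p\<in>?P. p ^ e p) ` PiE ?P (\<lambda>p. {..multiplicity p N}) \<subseteq> {\<delta>. \<delta> dvd N}"
  proof safe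
    fix e assume "e \<in> PiE ?P (\<lambda>p. {..multiplicity p N})"
    then show "(\<Prod>p\<in>?P. p ^ e p) dvd N"
      by (intro multiplicity_le_imp_dvd[OF nz]) (auto simp: mult)
  qed
qed

text \<open>This is the distributive law for a product of sums, transported along the bijection with
  exponent vectors.\<close>

lemma sum_divisors_prod:
  fixes F :: "nat \<Rightarrow> nat \<Rightarrow> 'a :: comm_semiring_1"
  assumes "N > 0"
  shows "(\<Sum>\<delta> | \<delta> dvd N. \<Prod>p\<in>prime_factors N. F p (multiplicity p \<delta>)) =
    (\<Prod>p\<in>prime_factors N. \<Sum>i\<le>multiplicity p N. F p i)"
proof -
  have "(\<Prod>p\<in>prime_factors N. \<Sum>i\<le>multiplicity p N. F p i) =
      (\<Sum>e\<in>PiE (prime_factors N) (\<lambda>p. {..multiplicity p N}). \<Prod>p\<in>prime_factors N. F p (e p))"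
    by (rule prod_sum_PiE) auto
  also have "\<dots> = (\<Sum>\<delta> | \<delta> dvd N. \<Prod>p\<in>prime_factors N.
      F p (restrict (\<lambda>p. multiplicity p \<delta>) (prime_factors N) p))"
    by (rule sum.reindex_bij_betw[OF bij_betw_divisors_PiE[OF assms], symmetric])
  finally show ?thesis by simp
qed

lemma GCD_div_C_div:
  assumes "N > 0" "d dvd N" "d \<noteq> 1"
  shows "GCD_div N (C_div N d) = int (gcd d (N div d) div rad (gcd d (N div d))) *
    col_gcd (prime_factors N) (\<lambda>p. multiplicity p N) (\<lambda>p. multiplicity p d)"
    (is "_ = ?c * col_gcd ?P ?r ?f")
proof -
  let ?D = "\<lambda>\<delta>. col_diff ?P ?r ?f (\<lambda>p. multiplicity p \<delta>)"
  have "V_div N (C_div N d) ` {\<delta>. \<delta> dvd N} = (*) ?c ` ?D ` {\<delta>. \<delta> dvd N}"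
    unfolding image_image by (intro image_cong refl) (simp add: V_div_eq_col_diff[OF assms(1,2,3)])
  then have "GCD_div N (C_div N d) = \<bar>?c * Gcd (?D ` {\<delta>. \<delta> dvd N})\<bar>"
    by (simp add: GCD_div_def Gcd_mult)
  also have "Gcd (?D ` {\<delta>. \<delta> dvd N}) = col_gcd ?P ?r ?f"
  proof (rule int_eqI_dvd)
    fix x
    \<comment> \<open>Exponents bounded by those of \<open>N\<close> come from a divisor. Any larger
      exponent makes both products zero, so the gcd over all \<open>e\<close> equals the gcd over
      divisors.\<close>
    have "x dvd col_diff ?P ?r ?f e" if x: "\<And>\<delta>. \<delta> dvd N \<Longrightarrow> x dvd ?D \<delta>" for e
    proof (cases "\<forall>p\<in>?P. e p \<le> multiplicity p N")
      case True
      then have "restrict e ?P \<in> PiE ?P (\<lambda>p. {..multiplicity p N})" by auto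
      then obtain \<delta> where "\<delta> dvd N" "restrict e ?P = restrict (\<lambda>p. multiplicity p \<delta>) ?P"
        using bij_betw_imp_surj_on[OF bij_betw_divisors_PiE[OF assms(1)]] by blast
      then have "?D \<delta> = col_diff ?P ?r ?f e"
        by (intro col_diff_cong) (simp_all, metis restrict_apply')
      then show ?thesis using x[OF \<open>\<delta> dvd N\<close>] by simp
    next
      case False
      then obtain p where p: "p \<in> ?P" "e p > multiplicity p N" by force
      then have "1 \<le> multiplicity p N" "multiplicity p d \<le> multiplicity p N"
        using assms by (auto simp: prime_factors_multiplicity dvd_imp_multiplicity_le)
      then have "col_one p (?r p) (?f p) (e p) = 0" "col_d p (?r p) (?f p) (e p) = 0"
        using p(2) by (auto simp: col_one_def col_d_def)
      then have "col_diff ?P ?r ?f e = 0"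
        unfolding col_diff_def using p(1) by (subst (1 2) prod_zero) auto
      then show ?thesis by simp
    qed
    then show "x dvd Gcd (?D ` {\<delta>. \<delta> dvd N}) \<longleftrightarrow> x dvd col_gcd ?P ?r ?f"
      unfolding dvd_Gcd_iff dvd_col_gcd_iff by blast
  qed (rule Gcd_int_greater_eq_0, simp)
  finally show ?thesis by (simp add: abs_mult)
qed

text \<open>Keeping the gcd as a factor on the left avoids the division in \<open>VV_div\<close>;
  the common factor \<open>z / rad z\<close> cancels because it is nonzero.\<close>

lemma col_gcd_mult_Pw_div:
  assumes "N > 0" "d dvd N" "d \<noteq> 1"
  shows "col_gcd (prime_factors N) (\<lambda>p. multiplicity p N) (\<lambda>p. multiplicity p d) * Pw_div N p (C_div N d) =
    (\<Sum>\<delta> | \<delta> dvd N \<and> odd (multiplicity p \<delta>).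
      col_diff (prime_factors N) (\<lambda>p. multiplicity p N) (\<lambda>p. multiplicity p d) (\<lambda>p. multiplicity p \<delta>))"
    (is "?G * _ = (\<Sum>\<delta> | _. ?D \<delta>)")
proof -
  let ?z = "gcd d (N div d)"
  let ?c = "int (?z div rad ?z)"
  have "GCD_div N (C_div N d) * VV_div N (C_div N d) \<delta> = V_div N (C_div N d) \<delta>" if "\<delta> dvd N" for \<delta>
    using that unfolding VV_div_def GCD_div_def by (intro dvd_mult_div_cancel Gcd_dvd) auto
  then have "?c * ?G * Pw_div N p (C_div N d) = (\<Sum>\<delta> | \<delta> dvd N \<and> odd (multiplicity p \<delta>). V_div N (C_div N d) \<delta>)"
    unfolding Pw_div_def GCD_div_C_div[OF assms, symmetric] sum_distrib_left by (intro sum.cong) auto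
  also have "\<dots> = ?c * (\<Sum>\<delta> | \<delta> dvd N \<and> odd (multiplicity p \<delta>). ?D \<delta>)"
    unfolding sum_distrib_left by (intro sum.cong) (auto simp: V_div_eq_col_diff[OF assms])
  finally have "?c * (?G * Pw_div N p (C_div N d)) = \<dots>" by (simp only: mult.assoc)
  moreover have "?c \<noteq> 0"
    unfolding gcd_div_div_rad[OF assms(1,2)] by (auto simp: in_prime_factors_iff)
  ultimately show ?thesis by simp
qed

section \<open>Weighted column sums and the product formula for Pw\<close>

lemma sum_col_one:
  assumes "1 \<le> r"
  shows "(\<Sum>i\<le>r. w i * col_one p r f i) =
    (if 0 < f \<and> f < r then int p - 1 else 1) * (w 0 * int p - w 1)"
proof -
  have "w i * col_one p r f i = (if 0 < f \<and> f < r then int p - 1 else 1) *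
      ((if i = 0 then w 0 * int p else 0) - (if i = 1 then w 1 else 0))" for i
    by (simp add: col_one_def)
  then show ?thesis
    using assms by (simp add: sum_distrib_left[symmetric] sum_subtractf)
qed

text \<open>The weight \<open>w\<close> serves two purposes, here and in \<open>sum_col_one\<close>:
  constant 1 for the full column sum, and the parity indicator for the sum over odd rows.\<close>

lemma sum_col_d:
  assumes "1 \<le> r" "f \<le> r"
  shows "(\<Sum>i\<le>r. w i * col_d p r f i) = w f * (if f = 0 \<or> f = r then int p else (int p)\<^sup>2 + 1) -
    (if 0 < f \<and> f < r then int p else 1) * ((if f < r then w (f + 1) else 0) + (if 0 < f then w (f - 1) else 0))"
proof -
  let ?y = "if 0 < f \<and> f < r then int p else 1"
  \<comment> \<open>For \<open>f = 0\<close> the index \<open>f - 1\<close> truncates to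
    \<open>f\<close> itself, so the guard \<open>0 < f\<close> is what suppresses the missing
    neighbour.\<close>
  have "w i * col_d p r f i = (if i = f then w f * (if f = 0 \<or> f = r then int p else (int p)\<^sup>2 + 1) else 0)
      - ?y * ((if i = f + 1 then if f < r then w (f + 1) else 0 else 0) +
              (if i = f - 1 then if 0 < f then w (f - 1) else 0 else 0))" if "i \<le> r" for i
    using that assms(2) by (auto simp: col_d_def)
  then have "(\<Sum>i\<le>r. w i * col_d p r f i) = (\<Sum>i\<le>r. (if i = f then w f * (if f = 0 \<or> f = r then int p else (int p)\<^sup>2 + 1) else 0)
      - ?y * ((if i = f + 1 then if f < r then w (f + 1) else 0 else 0) +
              (if i = f - 1 then if 0 < f then w (f - 1) else 0 else 0)))"
    by (intro sum.cong) auto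
  then show ?thesis
    using assms by (auto simp: sum_distrib_left[symmetric] sum_subtractf sum.distrib)
qed

text \<open>The sum of all entries of the local column \<open>col_one\<close>, which is also that of
  \<open>col_d\<close>.\<close>

definition col_sum :: "nat \<Rightarrow> nat \<Rightarrow> nat \<Rightarrow> int" where
  "col_sum p r f = (if 0 < f \<and> f < r then (int p - 1)\<^sup>2 else int p - 1)"

text \<open>The sum of \<open>col_one\<close> over odd rows minus that of \<open>col_d\<close>,
  divided by \<open>p + 1\<close>.\<close>

definition Pw_coeff :: "nat \<Rightarrow> nat \<Rightarrow> nat \<Rightarrow> int" where
  "Pw_coeff p r f = (if f = 0 \<or> f = r \<and> even r then 0 else if f = r then - 1
     else if even f then 1 else - int p)"

text \<open>Each of the two sums over divisors factors over the primes. Away from \<open>p\<close>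
  their factors agree and come out, so only the odd-row difference at \<open>p\<close>
  remains.\<close>

lemma col_gcd_mult_Pw_div_prime:
  assumes "N > 0" "d dvd N" "d \<noteq> 1" "p \<in> prime_factors N"
  shows "col_gcd (prime_factors N) (\<lambda>p. multiplicity p N) (\<lambda>p. multiplicity p d) * Pw_div N p (C_div N d) =
    Pw_coeff p (multiplicity p N) (multiplicity p d) * (int p + 1) *
    (\<Prod>q\<in>prime_factors N - {p}. col_sum q (multiplicity q N) (multiplicity q d))"
proof -
  let ?P = "prime_factors N"
  have P: "1 \<le> multiplicity q N" "multiplicity q d \<le> multiplicity q N" if "q \<in> ?P" for q
    using that assms by (auto simp: prime_factors_multiplicity dvd_imp_multiplicity_le)
  \<comment> \<open>The restriction to odd valuations becomes a local weight at \<open>p\<close>, so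
    that \<open>sum_divisors_prod\<close> applies.\<close>
  define w where "w = (\<lambda>q (i :: nat). if q = p then of_bool (odd i) else 1 :: int)"
  have w_prod: "(\<Prod>q\<in>?P. w q (e q) * g q) = of_bool (odd (e p)) * (\<Prod>q\<in>?P. g q)"
    for e g
  proof -
    have "(\<Prod>q\<in>?P. w q (e q)) = of_bool (odd (e p)) * (\<Prod>q\<in>?P - {p}. w q (e q))"
      using assms(4) by (subst prod.remove[of _ p]) (auto simp: w_def)
    also have "(\<Prod>q\<in>?P - {p}. w q (e q)) = 1"
      by (intro prod.neutral) (auto simp: w_def)
    finally show ?thesis by (simp add: prod.distrib)
  qed
  have sum: "(\<Sum>\<delta> | \<delta> dvd N \<and> odd (multiplicity p \<delta>). \<Prod>q\<in>?P. g q (multiplicity q \<delta>))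
      = (\<Sum>i\<le>multiplicity p N. of_bool (odd i) * g p i) * (\<Prod>q\<in>?P - {p}. \<Sum>i\<le>multiplicity q N. g q i)"
    for g :: "nat \<Rightarrow> nat \<Rightarrow> int"
  proof -
    have "(\<Sum>\<delta> | \<delta> dvd N \<and> odd (multiplicity p \<delta>). \<Prod>q\<in>?P. g q (multiplicity q \<delta>))
        = (\<Sum>\<delta> | \<delta> dvd N. of_bool (odd (multiplicity p \<delta>)) * (\<Prod>q\<in>?P. g q (multiplicity q \<delta>)))"
      using assms(1) by (intro sum.mono_neutral_cong_left) auto
    also have "\<dots> = (\<Sum>\<delta> | \<delta> dvd N. \<Prod>q\<in>?P. w q (multiplicity q \<delta>) * g q (multiplicity q \<delta>))"
      by (simp add: w_prod)
    also have "\<dots> = (\<Prod>q\<in>?P. \<Sum>i\<le>multiplicity q N. w q i * g q i)"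
      by (rule sum_divisors_prod[OF assms(1), of "\<lambda>q i. w q i * g q i"])
    also have "\<dots> = (\<Sum>i\<le>multiplicity p N. w p i * g p i) * (\<Prod>q\<in>?P - {p}. \<Sum>i\<le>multiplicity q N. w q i * g q i)"
      using assms(4) by (intro prod.remove) auto
    also have "(\<Prod>q\<in>?P - {p}. \<Sum>i\<le>multiplicity q N. w q i * g q i) = (\<Prod>q\<in>?P - {p}. \<Sum>i\<le>multiplicity q N. g q i)"
      by (intro prod.cong) (auto simp: w_def)
    finally show ?thesis by (simp add: w_def)
  qed
  have one: "(\<Prod>q\<in>?P - {p}. \<Sum>i\<le>multiplicity q N. col_one q (multiplicity q N) (multiplicity q d) i) =
      (\<Prod>q\<in>?P - {p}. col_sum q (multiplicity q N) (multiplicity q d))"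
  proof (intro prod.cong refl)
    fix q assume "q \<in> ?P - {p}"
    then show "(\<Sum>i\<le>multiplicity q N. col_one q (multiplicity q N) (multiplicity q d) i) =
        col_sum q (multiplicity q N) (multiplicity q d)"
      using sum_col_one[of "multiplicity q N" "\<lambda>_. 1" q "multiplicity q d"] P[of q]
      by (simp add: col_sum_def power2_eq_square)
  qed
  have d: "(\<Prod>q\<in>?P - {p}. \<Sum>i\<le>multiplicity q N. col_d q (multiplicity q N) (multiplicity q d) i) =
      (\<Prod>q\<in>?P - {p}. col_sum q (multiplicity q N) (multiplicity q d))"
  proof (intro prod.cong refl)
    fix q assume "q \<in> ?P - {p}"
    then show "(\<Sum>i\<le>multiplicity q N. col_d q (multiplicity q N) (multiplicity q d) i) =
        col_sum q (multiplicity q N) (multiplicity q d)"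
      using sum_col_d[of "multiplicity q N" "multiplicity q d" "\<lambda>_. 1" q] P[of q]
      by (auto simp: col_sum_def power2_eq_square algebra_simps)
  qed
  have "(\<Sum>i\<le>multiplicity p N. of_bool (odd i) * col_one p (multiplicity p N) (multiplicity p d) i) -
      (\<Sum>i\<le>multiplicity p N. of_bool (odd i) * col_d p (multiplicity p N) (multiplicity p d) i) =
      Pw_coeff p (multiplicity p N) (multiplicity p d) * (int p + 1)"
    unfolding sum_col_one[OF P(1)[OF assms(4)]] sum_col_d[OF P[OF assms(4)]]
    using P[OF assms(4)] by (auto simp: Pw_coeff_def power2_eq_square algebra_simps)
  then show ?thesis
    unfolding col_gcd_mult_Pw_div[OF assms(1-3)] col_diff_def sum_subtractf
      sum[of "\<lambda>q. col_one q (multiplicity q N) (multiplicity q d)"]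
      sum[of "\<lambda>q. col_d q (multiplicity q N) (multiplicity q d)"] one d
      left_diff_distrib[symmetric] by (simp only:)
qed

lemma Pw_div_not_prime_factor:
  assumes "prime p" "p \<notin> prime_factors N" "N > 0"
  shows "Pw_div N p C = 0"
proof -
  have "{\<delta>. \<delta> dvd N \<and> odd (multiplicity p \<delta>)} = {}"
    using assms dvd_imp_multiplicity_le[of _ N p] by (force simp: prime_factors_multiplicity)
  then show ?thesis unfolding Pw_div_def by (simp only: sum.empty)
qed


section \<open>The gcd\<close>

lemma prod_prime_factors_squarefree:
  fixes M :: nat
  assumes "squarefree M"
  shows "\<Prod>(prime_factors M) = M"
proof -
  have "M \<noteq> 0" using assms not_squarefree_0 by metis
  then have "M = (\<Prod>p\<in>prime_factors M. p ^ multiplicity p M)"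
    by (intro prime_factorization_nat) auto
  also have "\<dots> = \<Prod>(prime_factors M)"
    using assms \<open>M \<noteq> 0\<close> by (intro prod.cong) (auto simp: squarefree_factorial_semiring')
  finally show ?thesis by simp
qed

text \<open>For \<open>M = 1\<close> the convention \<open>g(1) = 0\<close> matches the gcd over an
  empty set of primes, where both products are 1.\<close>

lemma col_gcd_eq_g_squarefree:
  assumes "squarefree M" "\<And>p. p \<in> prime_factors M \<Longrightarrow> r p = 1 \<and> f p = 1"
  shows "col_gcd (prime_factors M) r f = g_squarefree M"
proof (cases "M = 1")
  case False
  then have "prime_factors M \<noteq> {}"
    using assms(1) by (metis finite_set_mset prod.empty prod_prime_factors_squarefree)
  then have "col_gcd (prime_factors M) r f =
      Gcd (insert (int (\<Prod>(prime_factors M)) + (- 1) ^ (card (prime_factors M) - 1))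
        ((\<lambda>p. (int p)\<^sup>2 - 1) ` prime_factors M))"
    using assms(2) by (intro col_gcd_squarefree) auto
  then show ?thesis
    unfolding prod_prime_factors_squarefree[OF assms(1)] g_squarefree_def using False by simp
qed (simp add: g_squarefree_def)

text \<open>The general \<open>r\<close> and \<open>f\<close> allow two uses: for \<open>d\<close>
  itself if \<open>z = 1\<close>, and for \<open>d / z\<close> after removal of a prime
  \<open>z\<close>. Primes of \<open>P\<close> not dividing \<open>d\<close> have
  \<open>f p = 0\<close> and drop out.\<close>

lemma col_gcd_eq_g1:
  assumes P: "finite P" "\<And>p. p \<in> P \<Longrightarrow> prime p" "\<And>p. p \<in> P \<Longrightarrow> 1 \<le> r p"
    and d: "d > 0" "prime_factors d \<subseteq> P"
    and f: "\<And>p. p \<in> P \<Longrightarrow> f p = multiplicity p d" "\<And>p. p \<in> prime_factors d \<Longrightarrow> r p = multiplicity p d"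
  shows "col_gcd P r f = g1 d"
proof -
  let ?Q = "prime_factors d"
  have "f p = 0" if "p \<in> P - ?Q" for p
    using that f(1)[of p] P(2)[of p] by (auto simp: prime_factors_multiplicity)
  then have "col_gcd (?Q \<union> (P - ?Q)) r f = col_gcd ?Q r f"
    using P by (intro col_gcd_level_zero) auto
  moreover have "?Q \<union> (P - ?Q) = P"
    using d(2) by blast
  ultimately have PQ: "col_gcd P r f = col_gcd ?Q r f"
    by simp
  have Q: "f p = multiplicity p d" "f p \<le> r p" "1 \<le> r p" if "p \<in> ?Q" for p
    using that d(2) f(1) f(2)[of p] P(3)[of p] by auto
  \<comment> \<open>Every decomposition of this shape gives the same value, which settles uniqueness
    for the definite description in \<open>g1\<close>.\<close>
  have one: "col_gcd ?Q r f = gcd (int p) (g_squarefree M)"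
    if p: "prime p" "d = M * p\<^sup>2" "coprime M p" "squarefree M" for p M
  proof -
    have "\<not> p dvd M"
      using p(1,3) not_prime_unit[of p] by (metis coprime_common_divisor dvd_refl)
    then have M: "M \<noteq> 0" "multiplicity p M = 0"
      by (metis dvd_0_right, rule not_dvd_imp_multiplicity_0)
    have mp: "multiplicity p d = 2"
      using p M by (simp add: prime_elem_multiplicity_mult_distrib)
    then have pQ: "p \<in> ?Q"
      using p(1) by (simp add: prime_factors_multiplicity)
    have mq: "multiplicity q d = multiplicity q M" if "prime q" "q \<noteq> p" for q
      using that p M by (simp add: prime_elem_multiplicity_mult_distrib multiplicity_distinct_prime_power)
    have QM: "?Q - {p} = prime_factors M"
      using mq M(2) by (auto simp: prime_factors_multiplicity) (metis less_not_refl)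
    have "col_gcd ?Q r f = gcd (int p) (col_gcd (?Q - {p}) r f)"
      using pQ Q mp f(2) by (intro col_gcd_prime) auto
    also have "col_gcd (?Q - {p}) r f = g_squarefree M"
      unfolding QM
    proof (rule col_gcd_eq_g_squarefree[OF p(4)])
      fix q assume q: "q \<in> prime_factors M"
      then have "q \<in> ?Q" "q \<noteq> p" "prime q" using QM by auto
      moreover have "multiplicity q M = 1"
        using p(4) M q by (simp add: squarefree_factorial_semiring')
      ultimately show "r q = 1 \<and> f q = 1"
        using mq Q(1) f(2) by simp
    qed
    finally show ?thesis .
  qed
  consider (sf) "squarefree d"
    | (one) "\<not> squarefree d" "\<exists>p M. prime p \<and> d = M * p\<^sup>2 \<and> coprime M p \<and> squarefree M"
    | (many) "\<not> squarefree d" "\<not> (\<exists>p M. prime p \<and> d = M * p\<^sup>2 \<and> coprime M p \<and> squarefree M)"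
    by blast
  then show ?thesis
  proof cases
    case sf
    then have "col_gcd ?Q r f = g_squarefree d"
      using Q f(2) d(1) by (intro col_gcd_eq_g_squarefree) (auto simp: squarefree_factorial_semiring')
    with sf show ?thesis by (simp add: g1_def PQ)
  next
    \<comment> \<open>Either some valuation is at least 3, or two different primes have valuation 2;
      in both situations the gcd is 1.\<close>
    case many
    then obtain p where p: "prime p" "p\<^sup>2 dvd d"
      using d(1) by (auto simp: squarefree_factorial_semiring)
    then have p2: "multiplicity p d \<ge> 2"
      using d(1) by (intro multiplicity_geI) auto
    have pQ: "p \<in> ?Q"
      using p p2 by (simp add: prime_factors_multiplicity)
    have "col_gcd ?Q r f = 1"
    proof (cases "multiplicity p d \<ge> 3")
      case True
      then show ?thesis
        using pQ Q f(2) by (intro col_gcd_trivial[of _ _ _ p]) auto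
    next
      case False
      then have mp: "multiplicity p d = 2" using p2 by simp
      then obtain M where M: "d = p\<^sup>2 * M" "\<not> p dvd M"
        using multiplicity_decompose'[of d p] d(1) p(1) not_prime_unit[of p] by (metis not_less0)
      have "M \<noteq> 0"
        using M(1) d(1) by auto
      have cop: "coprime M p"
        using prime_imp_coprime[OF p(1) M(2)] by (simp add: coprime_commute)
      then have "\<not> squarefree M"
        using many(2) p(1) M(1) cop by (metis mult.commute)
      then obtain q where q: "prime q" "q\<^sup>2 dvd M"
        using \<open>M \<noteq> 0\<close> by (auto simp: squarefree_factorial_semiring)
      then have "q\<^sup>2 dvd d" using M(1) by simp
      then have q2: "multiplicity q d \<ge> 2"
        using d(1) q(1) by (intro multiplicity_geI) auto
      have "p \<noteq> q" using q M(2) by (auto simp: power2_eq_square dest: dvd_mult_left)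
      have qQ: "q \<in> ?Q"
        using q q2 by (simp add: prime_factors_multiplicity)
      show ?thesis
      proof (cases "multiplicity q d \<ge> 3")
        case True
        then show ?thesis
          using qQ Q f(2) by (intro col_gcd_trivial[of _ _ _ q]) auto
      next
        case False
        then have "multiplicity q d = 2" using q2 by simp
        then show ?thesis
          using pQ qQ mp p(1) q(1) \<open>p \<noteq> q\<close> Q f(2) by (intro col_gcd_two_primes[of _ _ _ p q]) auto
      qed
    qed
    then show ?thesis
      unfolding g1_def PQ if_not_P[OF many(1)] if_not_P[OF many(2)] .
  next
    case one': one
    have "g1 d = col_gcd ?Q r f"
    proof -
      have "(THE v. \<exists>p M'. prime p \<and> d = M' * p\<^sup>2 \<and> coprime M' p \<and> squarefree M' \<and>
          v = gcd (int p) (g_squarefree M')) = col_gcd ?Q r f"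
      proof (rule the_equality)
        obtain p M where "prime p" "d = M * p\<^sup>2" "coprime M p" "squarefree M"
          using one'(2) by blast
        then show "\<exists>p M'. prime p \<and> d = M' * p\<^sup>2 \<and> coprime M' p \<and> squarefree M' \<and>
            col_gcd ?Q r f = gcd (int p) (g_squarefree M')"
          using one by blast
      qed (use one in auto)
      with one' show ?thesis by (simp add: g1_def)
    qed
    then show ?thesis by (simp add: PQ)
  qed
qed

lemma rad_1 [simp]: "rad (Suc 0) = Suc 0"
  by (simp add: rad_def)

lemma rad_prime:
  assumes "prime p"
  shows "rad p = p"
  using assms by (simp add: rad_def prime_factorization_prime)

lemma GCD_div_eq_g2:
  assumes "N > 0" "d dvd N" "d \<noteq> 1"
  shows "GCD_div N (C_div N d) = g2 N d"
proof -
  define z where "z = gcd d (N div d)"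
  let ?P = "prime_factors N" and ?r = "\<lambda>p. multiplicity p N" and ?f = "\<lambda>p. multiplicity p d"
  have G: "GCD_div N (C_div N d) = int (z div rad z) * col_gcd ?P ?r ?f"
    unfolding z_def by (rule GCD_div_C_div[OF assms])
  have "d > 0" "z > 0"
    using assms by (auto simp: z_def intro: dvd_pos_nat)
  have P: "prime p" "1 \<le> ?r p" "?f p \<le> ?r p" if "p \<in> ?P" for p
    using that assms by (auto simp: prime_factors_multiplicity dvd_imp_multiplicity_le)
  have mz: "multiplicity p z = min (?f p) (?r p - ?f p)" if "prime p" for p
    unfolding z_def using assms that by (intro multiplicity_gcd_div)
  \<comment> \<open>For \<open>d = N\<close> one has \<open>z = 1\<close>, and both branches of
    \<open>g2\<close> then give \<open>g1 d\<close>; three cases on \<open>z\<close> remain.\<close>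
  have g2: "g2 N d = (if z = 1 then g1 d
      else if prime z \<and> multiplicity z d = 1 then gcd (int z) (g1 (d div z))
      else int (z div rad z))"
    using assms(1) by (auto simp: g2_def z_def Let_def)
  consider "z = 1" | "prime z" "multiplicity z d = 1"
    | "z \<noteq> 1" "\<not> (prime z \<and> multiplicity z d = 1)" by auto
  then show ?thesis
  proof cases
    case 1
    have "prime_factors d \<subseteq> ?P"
      using assms(1,2) by (intro dvd_prime_factors) auto
    have "col_gcd ?P ?r ?f = g1 d"
    proof (rule col_gcd_eq_g1)
      fix p assume "p \<in> prime_factors d"
      \<comment> \<open>\<open>z = 1\<close> means that every prime of \<open>d\<close> occurs in
        \<open>d\<close> to the full power dividing \<open>N\<close>.\<close>
      then have "0 < ?f p" "min (?f p) (?r p - ?f p) = 0" "?f p \<le> ?r p"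
        using mz[of p] 1 assms by (auto simp: prime_factors_multiplicity dvd_imp_multiplicity_le)
      then show "?r p = ?f p" by auto
    qed (use P \<open>d > 0\<close> \<open>prime_factors d \<subseteq> ?P\<close> in auto)
    then show ?thesis using G g2 1 by simp
  next
    case 2
    have mzz: "multiplicity z z = 1"
      using 2 by simp
    then have r: "1 < ?r z" using mz[of z] 2 by simp
    have zP: "z \<in> ?P"
      using 2 r by (simp add: prime_factors_multiplicity)
    obtain k where k: "d = z * k" "\<not> z dvd k"
      using multiplicity_decompose'[of d z] \<open>d > 0\<close> 2 not_prime_unit[of z] by (metis not_less0 power_one_right)
    have "k > 0" using k(1) \<open>d > 0\<close> by simp
    have mk: "multiplicity q d = multiplicity q k" if "prime q" "q \<noteq> z" for q
      using that k(1) \<open>k > 0\<close> 2 by (simp add: prime_elem_multiplicity_mult_distrib prime_multiplicity_other)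
    have "col_gcd ?P ?r ?f = gcd (int z) (col_gcd (?P - {z}) ?r ?f)"
      using P zP r 2 by (intro col_gcd_prime) auto
    also have "col_gcd (?P - {z}) ?r ?f = g1 k"
    proof (rule col_gcd_eq_g1)
      fix p assume "p \<in> prime_factors k"
      then have p: "prime p" "p \<noteq> z" "0 < multiplicity p k"
        using k(2) by (auto simp: prime_factors_multiplicity not_dvd_imp_multiplicity_0)
      then have "multiplicity p z = 0"
        using 2 by (simp add: prime_multiplicity_other)
      then show "?r p = multiplicity p k"
        using mz[of p] mk[of p] p dvd_imp_multiplicity_le[OF assms(2), of p] assms(1) by auto
    next
      have "prime_factors k \<subseteq> ?P"
        using assms(1,2) k(1) by (intro dvd_prime_factors) (auto dest: dvd_mult_right)
      moreover have "z \<notin> prime_factors k"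
        using k(2) by auto
      ultimately show "prime_factors k \<subseteq> ?P - {z}" by blast
    qed (use P mk \<open>k > 0\<close> in auto)
    also have "k = d div z" using k(1) \<open>z > 0\<close> by simp
    finally show ?thesis
      using G g2 2 by (auto simp: rad_prime)
  next
    case 3
    have *: "0 < ?f p \<and> ?f p < ?r p \<and> p \<in> ?P" if "prime p" "p dvd z" for p
    proof -
      have "0 < multiplicity p z"
        using that \<open>z > 0\<close> by (simp add: prime_multiplicity_gt_zero_iff)
      then show ?thesis using mz[OF that(1)] that(1) by (auto simp: prime_factors_multiplicity)
    qed
    have "col_gcd ?P ?r ?f = 1"
    proof (cases "\<exists>p. prime p \<and> p dvd z \<and> ?f p \<ge> 2")
      case True
      then obtain p where "prime p" "p dvd z" "?f p \<ge> 2" by blast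
      then show ?thesis
        using *[of p] P by (intro col_gcd_trivial[of _ _ _ p]) auto
    next
      \<comment> \<open>Every prime dividing \<open>z\<close> now has valuation 1 in
        \<open>d\<close>, so \<open>z\<close> is not prime and has a second prime divisor; it
        differs from the first because \<open>p^2\<close> does not divide \<open>z\<close>.\<close>
      case False
      have f1: "?f p = 1" if "prime p" "p dvd z" for p
      proof -
        have "\<not> 2 \<le> ?f p" using False that by blast
        then show ?thesis using *[OF that] by linarith
      qed
      obtain p where p: "prime p" "p dvd z"
        using 3(1) by (metis prime_factor_nat)
      then have fp: "?f p = 1" by (rule f1)
      then have "z \<noteq> p" using 3(2) p by auto
      then obtain k where k: "z = p * k" "k \<noteq> 1" using p(2) by auto
      obtain q where q: "prime q" "q dvd k" using k(2) by (metis prime_factor_nat)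
      then have "q dvd z" using k(1) by simp
      with q(1) have fq: "?f q = 1" by (rule f1)
      have "p \<noteq> q"
      proof
        assume "p = q"
        then have "p ^ 2 dvd z" using q(2) k(1) by (simp add: power2_eq_square)
        then have "2 \<le> multiplicity p z" using p(1) \<open>z > 0\<close> by (intro multiplicity_geI) auto
        then show False using mz[OF p(1)] fp by simp
      qed
      then show ?thesis
        using *[OF p] *[OF q(1) \<open>q dvd z\<close>] fp fq p(1) q(1) P
        by (intro col_gcd_two_primes[of _ _ _ p q]) auto
    qed
    then show ?thesis using G g2 3 by auto
  qed
qed


section \<open>Parity\<close>

text \<open>For odd \<open>w\<close> the 2-parts of \<open>G\<close> and
  \<open>(p + 1) * (q - 1)\<close> agree. The divisibility of \<open>p^2 - 1\<close> and
  \<open>q^2 - 1\<close> by \<open>G\<close> gives one implication in each equivalence; that of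
  \<open>p * q - 1\<close> gives the other by induction on the exponent.\<close>

lemma two_power_dvd_iff_of_parity:
  fixes p q G w :: int
  assumes "odd p" "odd q" "odd w" "p + 1 \<noteq> 0" "q - 1 \<noteq> 0"
    and G: "G dvd p * q - 1" "G dvd p\<^sup>2 - 1" "G dvd q\<^sup>2 - 1"
    and eq: "G * w = - ((p + 1) * (q - 1))"
  shows "2 ^ k dvd p - 1 \<longleftrightarrow> 2 ^ k dvd q - 1" "2 ^ k dvd p + 1 \<longleftrightarrow> 2 ^ k dvd q + 1"
proof -
  have cop: "coprime (2 ^ k) w" for k
    using assms(3) by simp
  have dvd_G: "2 ^ k dvd p * q - 1" if "2 ^ k dvd (p + 1) * (q - 1)" for k
  proof -
    have "2 ^ k dvd G * w" using that unfolding eq by simp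
    then have "2 ^ k dvd G" using cop by (simp add: coprime_dvd_mult_left_iff)
    then show ?thesis using G(1) by (rule dvd_trans)
  qed
  have dvd_Gw: "(p + 1) * (q - 1) dvd x * w" if "G dvd x" for x
    using mult_dvd_mono[OF that dvd_refl[of w]] unfolding eq by simp
  have "(p + 1) * (q - 1) dvd (p + 1) * ((p - 1) * w)"
    using dvd_Gw[OF G(2)] by (simp add: power2_eq_square algebra_simps)
  then have 1: "q - 1 dvd (p - 1) * w"
    using assms(4) by (simp only: dvd_mult_cancel_left) simp
  have "(q - 1) * (p + 1) dvd (q - 1) * ((q + 1) * w)"
    using dvd_Gw[OF G(3)] by (simp add: power2_eq_square algebra_simps)
  then have 2: "p + 1 dvd (q + 1) * w"
    using assms(5) by (simp only: dvd_mult_cancel_left) simp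
  show "2 ^ k dvd p - 1 \<longleftrightarrow> 2 ^ k dvd q - 1"
  proof
    assume "2 ^ k dvd q - 1"
    then have "2 ^ k dvd (p - 1) * w" using 1 by (rule dvd_trans)
    then show "2 ^ k dvd p - 1" using cop by (simp add: coprime_dvd_mult_left_iff)
  next
    assume k: "2 ^ k dvd p - 1"
    \<comment> \<open>The even factor \<open>p + 1\<close> supplies one more power of 2 than
      \<open>q - 1\<close> alone, and this passes through \<open>G\<close> to
      \<open>p * q - 1\<close>.\<close>
    have "2 ^ j dvd q - 1" if "j \<le> k" for j
      using that
    proof (induction j)
      case (Suc j)
      then have "2 * 2 ^ j dvd (p + 1) * (q - 1)"
        using assms(1) by (intro mult_dvd_mono) auto
      then have "2 ^ Suc j dvd p * q - 1" using dvd_G[of "Suc j"] by simp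
      moreover have "2 ^ Suc j dvd (p - 1) * q"
        using k Suc.prems by (meson dvd_mult2 le_imp_power_dvd dvd_trans)
      moreover have "q - 1 = (p * q - 1) - (p - 1) * q" by (simp add: algebra_simps)
      ultimately show ?case by (metis dvd_diff)
    qed simp
    then show "2 ^ k dvd q - 1" by simp
  qed
  show "2 ^ k dvd p + 1 \<longleftrightarrow> 2 ^ k dvd q + 1"
  proof
    assume "2 ^ k dvd p + 1"
    then have "2 ^ k dvd (q + 1) * w" using 2 by (rule dvd_trans)
    then show "2 ^ k dvd q + 1" using cop by (simp add: coprime_dvd_mult_left_iff)
  next
    assume k: "2 ^ k dvd q + 1"
    have "2 ^ j dvd p + 1" if "j \<le> k" for j
      using that
    proof (induction j)
      case (Suc j)
      then have "2 ^ j * 2 dvd (p + 1) * (q - 1)"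
        using assms(2) by (intro mult_dvd_mono) auto
      then have "2 ^ Suc j dvd p * q - 1" using dvd_G[of "Suc j"] by (simp add: mult.commute)
      moreover have "2 ^ Suc j dvd (q + 1) * p"
        using k Suc.prems by (meson dvd_mult2 le_imp_power_dvd dvd_trans)
      moreover have "p + 1 = (q + 1) * p - (p * q - 1)" by (simp add: algebra_simps)
      ultimately show ?case by (metis dvd_diff)
    qed simp
    then show "2 ^ k dvd p + 1" by simp
  qed
qed

lemma multiplicity_two_eqI:
  fixes a b :: nat
  assumes "a > 0" "b > 0" "\<And>k. (2 :: int) ^ k dvd int a \<longleftrightarrow> 2 ^ k dvd int b"
  shows "multiplicity 2 a = multiplicity 2 b"
proof -
  have "2 ^ k dvd a \<longleftrightarrow> 2 ^ k dvd b" for k :: nat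
    using assms(3)[of k] by (metis int_dvd_int_iff of_nat_numeral of_nat_power)
  then have "k \<le> multiplicity 2 a \<longleftrightarrow> k \<le> multiplicity 2 b" for k
    using assms(1,2) by (simp add: power_dvd_iff_le_multiplicity)
  then show ?thesis by (meson dual_order.antisym le_refl)
qed

lemma same_2_valuations_of_parity:
  fixes p q :: nat
  assumes "odd p" "odd q" "p > 1" "q > 1" "odd w"
    and "G dvd int p * int q - 1" "G dvd (int p)\<^sup>2 - 1" "G dvd (int q)\<^sup>2 - 1"
    and "G * w = - ((int p + 1) * (int q - 1))"
  shows "same_2_valuations p q"
  unfolding same_2_valuations_def
  using two_power_dvd_iff_of_parity[of "int p" "int q" w G] assms
  by (intro conjI multiplicity_two_eqI) (auto simp: of_nat_diff add.commute)

text \<open>With common valuations \<open>x\<close> and \<open>y\<close>, all three generators are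
  divisible by \<open>2^(x+y)\<close>, hence so is \<open>G\<close>. But
  \<open>(p + 1) * (q - 1)\<close> has 2-adic valuation exactly \<open>x + y\<close>, so no factor 2
  is left for \<open>w\<close>.\<close>

lemma odd_of_same_2_valuations:
  fixes p q :: nat
  assumes "odd p" "odd q" "p > 1" "q > 1" "same_2_valuations p q"
    and G: "\<And>x. x dvd int p * int q - 1 \<Longrightarrow> x dvd (int p)\<^sup>2 - 1 \<Longrightarrow> x dvd (int q)\<^sup>2 - 1 \<Longrightarrow> x dvd G"
    and eq: "G * w = - ((int p + 1) * (int q - 1))"
  shows "odd w"
proof
  assume "even w"
  define x y where "x = multiplicity 2 (p - 1)" and "y = multiplicity 2 (p + 1)"
  have xy: "multiplicity 2 (q - 1) = x" "multiplicity 2 (q + 1) = y"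
    using assms(5) by (simp_all add: x_def y_def same_2_valuations_def)
  have dec: "\<exists>t. n = 2 ^ multiplicity 2 n * t \<and> odd t" if "n > 0" for n :: nat
    using multiplicity_decompose'[of n 2] that by auto
  obtain u where u: "p - 1 = 2 ^ x * u" "odd u"
    using dec[of "p - 1"] assms(3) by (auto simp: x_def)
  obtain u' where u': "q - 1 = 2 ^ x * u'" "odd u'"
    using dec[of "q - 1"] assms(4) unfolding xy by auto
  obtain v where v: "p + 1 = 2 ^ y * v" "odd v"
    using dec[of "p + 1"] by (auto simp: y_def)
  obtain v' where v': "q + 1 = 2 ^ y * v'" "odd v'"
    using dec[of "q + 1"] unfolding xy by auto
  have p: "int p = 1 + 2 ^ x * int u" "int p = 2 ^ y * int v - 1"
    using arg_cong[OF u(1), of int] arg_cong[OF v(1), of int] assms(3) by (simp_all add: of_nat_diff)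
  have q: "int q = 1 + 2 ^ x * int u'" "int q = 2 ^ y * int v' - 1"
    using arg_cong[OF u'(1), of int] arg_cong[OF v'(1), of int] assms(4) by (simp_all add: of_nat_diff)
  have pos: "x \<ge> 1" "y \<ge> 1"
    unfolding x_def y_def using assms(1,3) by (auto intro!: multiplicity_geI)
  \<comment> \<open>\<open>p - 1\<close> and \<open>p + 1\<close> differ by 2, so 4 cannot divide
    both.\<close>
  have min: "x = 1 \<or> y = 1"
  proof (rule ccontr)
    assume "\<not> ?thesis"
    then have "2 \<le> x" "2 \<le> y" using pos by auto
    then have "2 ^ 2 dvd p - 1" "2 ^ 2 dvd p + 1"
      unfolding u(1) v(1) by (blast intro: dvd_mult2 le_imp_power_dvd)+
    then have "2 ^ 2 dvd (p + 1) - (p - 1)" by (rule dvd_diff_nat[rotated])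
    then show False using assms(3) by simp
  qed
  \<comment> \<open>If one valuation is 1, the other one gives the main power. The missing factor 2
    comes from a bracket with two odd terms and one even term.\<close>
  have "2 ^ (x + y) dvd int p * int q - 1"
    using min
  proof
    assume "y = 1"
    have "int p * int q - 1 = 2 ^ x * (int u + int u' + 2 ^ x * (int u * int u'))"
      unfolding p(1) q(1) by (simp add: algebra_simps)
    moreover have "2 dvd int u + int u' + 2 ^ x * (int u * int u')"
      using pos u(2) u'(2) by simp
    ultimately show ?thesis
      unfolding \<open>y = 1\<close> power_add by (simp only: power_one_right mult_dvd_mono[OF dvd_refl])
  next
    assume "x = 1"
    have "int p * int q - 1 = 2 ^ y * (2 ^ y * (int v * int v') - int v - int v')"
      unfolding p(2) q(2) by (simp add: algebra_simps)
    moreover have "2 dvd 2 ^ y * (int v * int v') - int v - int v'"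
      using pos v(2) v'(2) by simp
    ultimately show ?thesis
      unfolding \<open>x = 1\<close> add.commute[of 1] power_add by (simp only: power_one_right mult_dvd_mono[OF dvd_refl])
  qed
  moreover have "(int p)\<^sup>2 - 1 = 2 ^ (x + y) * (int u * int v)"
  proof -
    have "int p - 1 = 2 ^ x * int u" "int p + 1 = 2 ^ y * int v"
      using p by simp_all
    then have "(int p - 1) * (int p + 1) = 2 ^ (x + y) * (int u * int v)"
      by (simp add: power_add)
    then show ?thesis
      by (simp add: power2_eq_square algebra_simps)
  qed
  moreover have "(int q)\<^sup>2 - 1 = 2 ^ (x + y) * (int u' * int v')"
  proof -
    have "int q - 1 = 2 ^ x * int u'" "int q + 1 = 2 ^ y * int v'"
      using q by simp_all
    then have "(int q - 1) * (int q + 1) = 2 ^ (x + y) * (int u' * int v')"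
      by (simp add: power_add)
    then show ?thesis
      by (simp add: power2_eq_square algebra_simps)
  qed
  ultimately have "2 ^ (x + y) dvd G"
    by (intro G) simp_all
  then have "2 ^ (x + y) * 2 dvd G * w"
    using \<open>even w\<close> by (rule mult_dvd_mono)
  moreover have "G * w = 2 ^ (x + y) * - (int v * int u')"
  proof -
    have "int p + 1 = 2 ^ y * int v" "int q - 1 = 2 ^ x * int u'"
      using p q by simp_all
    then show ?thesis unfolding eq by (simp add: power_add)
  qed
  ultimately have "2 dvd - (int v * int u')"
    by (simp only: dvd_mult_cancel_left) simp
  then show False using v u' by simp
qed

section \<open>Parity of Pw from the local exponents\<close>

lemma even_col_sum: "odd q \<Longrightarrow> even (col_sum q r f)"
  by (simp add: col_sum_def)

lemma col_sum_2 [simp]: "col_sum 2 r f = 1"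
  by (simp add: col_sum_def)

lemma odd_prod_col_sum_iff:
  assumes "finite P" "\<And>q. q \<in> P \<Longrightarrow> prime q"
  shows "odd (\<Prod>q\<in>P. col_sum q (r q) (f q)) \<longleftrightarrow> P \<subseteq> {2}"
proof
  assume odd: "odd (\<Prod>q\<in>P. col_sum q (r q) (f q))"
  show "P \<subseteq> {2}"
  proof
    fix q assume q: "q \<in> P"
    then have "odd (col_sum q (r q) (f q))"
      using odd assms(1) by (meson dvd_prodI dvd_trans)
    then have "even q" using even_col_sum by blast
    then show "q \<in> {2}" using assms(2)[OF q] prime_odd_nat[of q] prime_ge_2_nat[of q] by force
  qed
next
  assume "P \<subseteq> {2}"
  then have "(\<Prod>q\<in>P. col_sum q (r q) (f q)) = 1"
    by (intro prod.neutral) auto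
  then show "odd (\<Prod>q\<in>P. col_sum q (r q) (f q))" by simp
qed

lemma prime_odd_or_2: "prime q \<Longrightarrow> odd q \<or> q = (2 :: nat)"
  using prime_odd_nat[of q] prime_ge_2_nat[of q] by force

text \<open>The parity argument sees \<open>N\<close> and \<open>d\<close> only through the primes
  of \<open>N\<close> and the two families of valuations.\<close>

locale local_data =
  fixes P :: "nat set" and r f :: "nat \<Rightarrow> nat"
  assumes finite: "finite P" and prime: "\<And>q. q \<in> P \<Longrightarrow> prime q"
    and r_ge: "\<And>q. q \<in> P \<Longrightarrow> 1 \<le> r q" and f_le: "\<And>q. q \<in> P \<Longrightarrow> f q \<le> r q"
begin

text \<open>An even gcd excludes primes that make the gcd 1, and a prime that makes it divide
  \<open>q\<close> must be 2.\<close>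

lemma even_col_gcd_not_trivial:
  assumes "even (col_gcd P r f)" "q \<in> P"
  shows "f q = 0 \<or> f q = 1 \<and> r q = 1 \<or> q = 2 \<and> (f q = 2 \<and> r q = 2 \<or> f q = 1 \<and> 1 < r q)"
proof -
  have "\<not> (f q = r q \<and> r q \<ge> 3 \<or> 2 \<le> f q \<and> f q < r q)"
    using col_gcd_trivial[of P f r q, OF finite f_le r_ge assms(2)] assms(1) by auto
  moreover have "q = 2" if "f q = 2 \<and> r q = 2 \<or> f q = 1 \<and> 1 < r q"
  proof -
    have "col_gcd P r f = gcd (int q) (col_gcd (P - {q}) r f)"
      using col_gcd_prime[of P f r q, OF finite f_le r_ge assms(2) that] .
    then have "even (int q)"
      using assms(1) by simp
    then show ?thesis using prime_odd_or_2[OF prime[OF assms(2)]] by auto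
  qed
  ultimately show ?thesis using f_le[OF assms(2)] by linarith
qed

lemma col_gcd_eq_Gcd:
  assumes "S \<subseteq> P" "S \<noteq> {}" "\<And>q. q \<in> S \<Longrightarrow> f q = 1 \<and> r q = 1" "\<And>q. q \<in> P - S \<Longrightarrow> f q = 0"
  shows "col_gcd P r f = Gcd (insert (int (\<Prod>S) + (- 1) ^ (card S - 1)) ((\<lambda>p. (int p)\<^sup>2 - 1) ` S))"
proof -
  have "col_gcd (S \<union> (P - S)) r f = col_gcd S r f"
    using assms finite r_ge by (intro col_gcd_level_zero) (auto intro: finite_subset)
  moreover have "S \<union> (P - S) = P" using assms(1) by blast
  moreover have "col_gcd S r f = Gcd (insert (int (\<Prod>S) + (- 1) ^ (card S - 1)) ((\<lambda>p. (int p)\<^sup>2 - 1) ` S))"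
    using assms finite prime by (intro col_gcd_squarefree) (auto intro: finite_subset)
  ultimately show ?thesis by simp
qed

lemma prime_square_minus_one_nonzero: "q \<in> P \<Longrightarrow> (int q)\<^sup>2 - 1 \<noteq> 0"
  using prime_gt_1_nat[OF prime[of q]] by (auto simp: power2_eq_1_iff)

text \<open>
  If \<open>p\<close> is not congruent to \<open>1\<close>, or one of the other primes not to \<open>3\<close>, modulo \<open>4\<close>, then the bound
  on the gcd given by that prime suffices; otherwise the gcd is not divisible by \<open>4\<close>.
\<close>

lemma even_of_three_primes:
  assumes S: "S \<subseteq> P" "\<And>q. q \<in> S \<Longrightarrow> odd q"
    and p: "p \<in> S" "q \<in> S" "q' \<in> S" "p \<noteq> q" "p \<noteq> q'" "q \<noteq> q'"
    and G: "G dvd int (\<Prod>S) + (- 1) ^ (card S - 1)" "\<And>q. q \<in> S \<Longrightarrow> G dvd (int q)\<^sup>2 - 1"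
    and dvd: "\<And>q q'. q \<in> S - {p} \<Longrightarrow> q' \<in> S - {p} \<Longrightarrow> q \<noteq> q' \<Longrightarrow>
        (int p + 1) * ((int q - 1) * (int q' - 1)) dvd G * w"
  shows "even w"
proof (rule ccontr)
  assume w: "odd w"
  have gt: "q > 1" if "q \<in> S" for q
    using that S(1) prime prime_gt_1_nat by blast
  have mod4: "int q mod 4 = 1 \<or> int q mod 4 = 3" if "q \<in> S" for q
    using S(2)[OF that] by presburger
  have Gw: "G * w dvd (int q - 1) * (int q + 1) * w" if "q \<in> S" for q
    using G(2)[OF that] by (intro mult_dvd_mono) (simp_all add: power2_eq_square algebra_simps)
  have not_4: "\<not> 4 dvd x * w" if "x mod 4 = 2" for x :: int
  proof
    assume "4 dvd x * w"
    moreover have "coprime 4 w"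
      using w coprime_power_left_iff[of 2 2 w] by simp
    ultimately have "4 dvd x" by (simp add: coprime_dvd_mult_left_iff)
    then show False using that by presburger
  qed
  have 4: "4 dvd (int a + b) * (int c + e)" if "a \<in> S" "c \<in> S" "odd b" "odd e" for a c b e
  proof -
    have "2 * 2 dvd (int a + b) * (int c + e)"
      using that S(2) by (intro mult_dvd_mono) auto
    then show ?thesis by simp
  qed
  \<comment> \<open>If \<open>a\<close> were 1 modulo 4, cancelling \<open>a - 1\<close> would leave
    a multiple of 4 dividing \<open>(a + 1) * w\<close>, although \<open>a + 1\<close> is 2 modulo
    4.\<close>
  have q3: "int a mod 4 = 3" if a: "a \<in> S - {p}" for a
  proof (rule ccontr)
    assume "int a mod 4 \<noteq> 3"
    then have a1: "int a mod 4 = 1" using mod4 a by auto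
    obtain b where b: "b \<in> S - {p}" "b \<noteq> a"
      using p by blast
    have "(int a - 1) * ((int p + 1) * (int b - 1)) dvd (int a - 1) * ((int a + 1) * w)"
      using dvd_trans[OF dvd[OF a b(1)] Gw[of a]] a b(2) by (simp add: mult_ac)
    then have "(int p + 1) * (int b - 1) dvd (int a + 1) * w"
      using gt[of a] a by (simp only: dvd_mult_cancel_left) simp
    then have "4 dvd (int a + 1) * w"
      using 4[of p b 1 "-1"] p(1) b(1) by (auto intro: dvd_trans)
    then show False using not_4[of "int a + 1"] a1 by presburger
  qed
  have p1: "int p mod 4 = 1"
  proof (rule ccontr)
    assume "int p mod 4 \<noteq> 1"
    then have p3: "int p mod 4 = 3" using mod4 p by auto
    have "(int p + 1) * ((int q - 1) * (int q' - 1)) dvd (int p + 1) * ((int p - 1) * w)"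
      using dvd_trans[OF dvd[of q q'] Gw[of p]] p by (simp add: mult_ac)
    then have "(int q - 1) * (int q' - 1) dvd (int p - 1) * w"
      by (simp only: dvd_mult_cancel_left) simp
    then have "4 dvd (int p - 1) * w"
      using 4[of q q' "-1" "-1"] p by (auto intro: dvd_trans)
    then show False using not_4[of "int p - 1"] p3 by presburger
  qed
  have finS: "finite S" using S(1) finite by (rule finite_subset)
  have "[(\<Prod>a\<in>S - {p}. int a) = (\<Prod>a\<in>S - {p}. - 1)] (mod 4)"
  proof (rule cong_prod)
    fix a assume "a \<in> S - {p}"
    then show "[int a = - 1] (mod 4)" using q3[of a] by (simp add: cong_def)
  qed
  then have "[int p * (\<Prod>a\<in>S - {p}. int a) = 1 * (- 1) ^ (card S - 1)] (mod 4)"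
    using p1 p(1) by (intro cong_mult) (auto simp: cong_def)
  moreover have "int (\<Prod>S) = int p * (\<Prod>a\<in>S - {p}. int a)"
    using prod.remove[OF finS p(1), of int] by simp
  \<comment> \<open>All primes of \<open>S\<close> other than \<open>p\<close> are -1 modulo 4, so
    the first generator is twice a sign modulo 4.\<close>
  ultimately have c: "[int (\<Prod>S) + (- 1) ^ (card S - 1) = (- 1) ^ (card S - 1) + (- 1) ^ (card S - 1)] (mod 4)"
    by (intro cong_add) simp_all
  have "4 dvd (int p + 1) * ((int q - 1) * (int q' - 1))"
    by (rule dvd_mult) (use 4[of q q' "-1" "-1"] p in auto)
  also have "\<dots> dvd G * w" using dvd p by blast
  also have "\<dots> dvd (int (\<Prod>S) + (- 1) ^ (card S - 1)) * w"
    using G(1) by (rule mult_dvd_mono) simp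
  finally have "4 dvd (int (\<Prod>S) + (- 1) ^ (card S - 1)) * w" .
  moreover have "((- 1) ^ k + (- 1) ^ k :: int) mod 4 = 2" for k :: nat
    by (cases "even k") simp_all
  ultimately show False using not_4 c unfolding cong_def by metis
qed

text \<open>\<open>w\<close> stands for \<open>Pw_p\<close>, and the equation is its product
  formula. The gcd is odd; or it is even and the prime 2 reduces it to a divisor of 2; or it is even
  and every positive exponent has \<open>f q = r q = 1\<close>.\<close>

lemma odd_Pw_imp:
  assumes "\<exists>q\<in>P. f q > 0" "p \<in> P" "odd w"
    and eq: "col_gcd P r f * w = Pw_coeff p (r p) (f p) * (int p + 1) * (\<Prod>q\<in>P - {p}. col_sum q (r q) (f q))"
  shows "P = {2} \<and> (f 2 = r 2 \<and> odd (r 2) \<or> f 2 = 1 \<and> 1 < r 2 \<or> even (f 2) \<and> 0 < f 2 \<and> f 2 < r 2) \<or>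
    (\<exists>q. q mod 4 = 1 \<and> P = {2, q} \<and> f q = 1 \<and> r q = 1 \<and> (f 2 = 2 \<and> r 2 = 2 \<or> f 2 = 1 \<and> 1 < r 2)) \<or>
    (\<exists>q. odd q \<and> P - {2} = {q} \<and> f q = 1 \<and> r q = 1 \<and> (2 \<in> P \<longrightarrow> f 2 = 0)) \<or>
    (\<exists>q q'. q \<noteq> q' \<and> P - {2} = {q, q'} \<and> f q = 1 \<and> r q = 1 \<and> f q' = 1 \<and> r q' = 1 \<and>
       (2 \<in> P \<longrightarrow> f 2 = 0) \<and> same_2_valuations q q')"
    (is "?A \<or> ?B \<or> ?C \<or> ?D")
proof -
  let ?G = "col_gcd P r f"
  let ?s = "\<lambda>q. col_sum q (r q) (f q)"
  let ?\<Pi> = "\<Prod>q\<in>P - {p}. ?s q"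
  have odd_\<Pi>: "odd ?\<Pi> \<longleftrightarrow> P - {p} \<subseteq> {2}"
    using finite prime by (intro odd_prod_col_sum_iff) auto
  have pp: "prime p" "f p \<le> r p" "1 \<le> r p"
    using prime f_le r_ge assms(2) by auto
  consider (odd) "odd ?G"
    | (two) "even ?G" "2 \<in> P" "f 2 = 2 \<and> r 2 = 2 \<or> f 2 = 1 \<and> 1 < r 2"
    | (sf) "even ?G" "\<And>q. q \<in> P \<Longrightarrow> f q = 0 \<or> f q = 1 \<and> r q = 1"
    using even_col_gcd_not_trivial by metis
  then show ?thesis
  proof cases
    \<comment> \<open>Every factor on the right is odd: \<open>p + 1\<close> forces
      \<open>p = 2\<close>, and the product then forces \<open>P = {2}\<close>.\<close>
    case odd
    then have o: "odd (Pw_coeff p (r p) (f p))" "odd (int p + 1)" "odd ?\<Pi>"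
      using assms(3) eq by (metis even_mult_iff)+
    then have "p = 2" using prime_odd_or_2[OF pp(1)] by auto
    moreover have "P = {2}" using o(3) odd_\<Pi> assms(2) \<open>p = 2\<close> by auto
    moreover have "f 2 = r 2 \<and> odd (r 2) \<or> even (f 2) \<and> 0 < f 2 \<and> f 2 < r 2"
      using o(1) pp(2) unfolding \<open>p = 2\<close> Pw_coeff_def by (auto split: if_splits)
    ultimately show ?thesis by blast
  next
    case two
    have "?G = gcd (int 2) (col_gcd (P - {2}) r f)"
      using col_gcd_prime[of P f r 2, OF finite f_le r_ge two(2,3)] .
    then have "?G dvd 2" by simp
    then have "?G = 2"
      using two(1) by (intro zdvd_antisym_nonneg) simp_all
    show ?thesis
    proof (cases "p = 2")
      case True
      \<comment> \<open>This excludes \<open>f 2 = r 2 = 2\<close>, where the coefficient is 0. What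
        remains has coefficient -2, which cancels the gcd.\<close>
      have "Pw_coeff p (r p) (f p) \<noteq> 0"
        using eq assms(3) \<open>?G = 2\<close> by auto
      then have f: "f 2 = 1" "1 < r 2"
        using two(3) True by (auto simp: Pw_coeff_def)
      then have "2 * w = 2 * (- 3 * ?\<Pi>)"
        using eq \<open>?G = 2\<close> True by (simp add: Pw_coeff_def)
      then have "w = - 3 * ?\<Pi>" by simp
      then have "odd ?\<Pi>" using assms(3) by auto
      then show ?thesis using odd_\<Pi> assms(2) True f by auto
    next
      case False
      then have "odd p" using prime_odd_or_2 pp(1) by blast
      have "Pw_coeff p (r p) (f p) \<noteq> 0"
        using eq assms(3) \<open>?G = 2\<close> by auto
      then have f: "f p = 1" "r p = 1"
        using even_col_gcd_not_trivial[OF two(1) assms(2)] False by (auto simp: Pw_coeff_def)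
      then have eq': "2 * w = - ((int p + 1) * ?\<Pi>)"
        using eq \<open>?G = 2\<close> by (simp add: Pw_coeff_def algebra_simps)
      \<comment> \<open>\<open>p + 1\<close> is already even, so an even product would make
        \<open>2 * w\<close> divisible by 4.\<close>
      have "odd ?\<Pi>"
      proof
        assume "even ?\<Pi>"
        then have "2 * 2 dvd (int p + 1) * ?\<Pi>"
          using \<open>odd p\<close> by (intro mult_dvd_mono) auto
        then have "2 * 2 dvd 2 * w" unfolding eq' by simp
        then show False using assms(3) by (simp only: dvd_mult_cancel_left) simp
      qed
      then have sub: "P - {p} \<subseteq> {2}" using odd_\<Pi> by simp
      then have "?\<Pi> = 1" by (intro prod.neutral) auto
      then have "2 * w = - (int p + 1)" using eq' by simp
      then have "p mod 4 = 1" using assms(3) by presburger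
      moreover have "P = {2, p}" using sub assms(2) two(2) by auto
      ultimately show ?thesis using f two(3) by blast
    qed
  next
    case sf
    define S where "S = {q \<in> P. f q = 1}"
    have S: "S \<subseteq> P" "S \<noteq> {}" "\<And>q. q \<in> S \<Longrightarrow> f q = 1 \<and> r q = 1" "\<And>q. q \<in> P - S \<Longrightarrow> f q = 0"
      using assms(1) sf(2) by (auto simp: S_def, force+)
    have finS: "finite S" using S(1) finite by (rule finite_subset)
    have G: "?G = Gcd (insert (int (\<Prod>S) + (- 1) ^ (card S - 1)) ((\<lambda>p. (int p)\<^sup>2 - 1) ` S))"
      by (rule col_gcd_eq_Gcd[OF S])
    have G1: "?G dvd int (\<Prod>S) + (- 1) ^ (card S - 1)"
      unfolding G by (rule Gcd_dvd) simp
    have G2: "?G dvd (int q)\<^sup>2 - 1" if "q \<in> S" for q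
      unfolding G using that by (intro Gcd_dvd) simp
    have "?G \<noteq> 0"
      using S(1,2) G2 prime_square_minus_one_nonzero by fastforce
    \<comment> \<open>The even gcd divides the product of \<open>S\<close> plus a sign, so this
      product is odd.\<close>
    have "2 \<notin> S"
    proof
      assume "2 \<in> S"
      then have "even (\<Prod>S)" using finS by (meson dvd_prodI dvd_refl dvd_trans)
      then have "even (int (\<Prod>S))" by (simp only: even_of_nat)
      moreover have "even (int (\<Prod>S) + (- 1) ^ (card S - 1))" using sf(1) G1 by (rule dvd_trans)
      ultimately show False by (simp del: of_nat_prod)
    qed
    then have oddS: "odd q" if "q \<in> S" for q
      using that S(1) prime prime_odd_or_2 by blast
    have f2: "f 2 = 0" if "2 \<in> P"
      using that \<open>2 \<notin> S\<close> S(4) by blast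
    have s: "?s q = int q - 1" if "q \<in> P" for q
      using sf(2)[OF that] by (auto simp: col_sum_def)
    have "Pw_coeff p (r p) (f p) \<noteq> 0"
      using eq assms(3) \<open>?G \<noteq> 0\<close> by auto
    then have "f p = 1" "r p = 1"
      using sf(2)[OF assms(2)] by (auto simp: Pw_coeff_def)
    then have pS: "p \<in> S" using assms(2) by (simp add: S_def)
    have eq': "?G * w = - ((int p + 1) * ?\<Pi>)"
      using eq \<open>f p = 1\<close> \<open>r p = 1\<close> by (simp add: Pw_coeff_def algebra_simps)
    consider (1) "S = {p}" | (2) q where "S = {p, q}" "p \<noteq> q"
      | (3) q q' where "q \<in> S" "q' \<in> S" "p \<noteq> q" "p \<noteq> q'" "q \<noteq> q'"
      using pS by blast
    then show ?thesis
    proof cases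
      case 1
      have "(int p)\<^sup>2 - 1 = (int p + 1) * (int p - 1)"
        by (simp add: power2_eq_square algebra_simps)
      then have "int p + 1 dvd ?G"
        unfolding G 1 by (intro Gcd_greatest) auto
      then have "?G = int p + 1"
        using G1 unfolding 1 by (intro zdvd_antisym_nonneg) simp_all
      then have "(int p + 1) * w = (int p + 1) * (- ?\<Pi>)" using eq' by simp
      then have "w = - ?\<Pi>" by (simp only: mult_cancel_left) linarith
      then have "odd ?\<Pi>" using assms(3) by simp
      then have "P - {2} = {p}"
        using odd_\<Pi> assms(2) \<open>2 \<notin> S\<close> pS by auto
      then show ?thesis
        using \<open>f p = 1\<close> \<open>r p = 1\<close> oddS[OF pS] f2 by blast
    next
      case 2
      have G12: "?G dvd int p * int q - 1" "?G dvd (int p)\<^sup>2 - 1" "?G dvd (int q)\<^sup>2 - 1"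
      proof -
        have "int (\<Prod>S) + (- 1) ^ (card S - 1) = int p * int q - 1"
          unfolding 2(1) using 2(2) by simp
        then show "?G dvd int p * int q - 1" using G1 by (simp only:)
        show "?G dvd (int p)\<^sup>2 - 1" "?G dvd (int q)\<^sup>2 - 1"
          using G2 2(1) by blast+
      qed
      have qP: "q \<in> P" using 2 S(1) by auto
      have "?G dvd (int p + 1) * (int q - 1)"
      proof -
        \<comment> \<open>This combination of the generators shows that the gcd divides
          \<open>(p + 1) * (q - 1)\<close>. The factors of all further primes then divide
          \<open>w\<close>, so the only further prime is 2.\<close>
        have "(int p + 1) * (int q - 1) = (int p * int q - 1) * (1 + int p) - int q * ((int p)\<^sup>2 - 1)"
          by (simp add: power2_eq_square algebra_simps)
        also have "?G dvd \<dots>" by (rule dvd_diff[OF dvd_mult2[OF G12(1)] dvd_mult[OF G12(2)]])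
        finally show ?thesis .
      qed
      then obtain k where k: "(int p + 1) * (int q - 1) = ?G * k" by blast
      have \<Pi>: "?\<Pi> = (int q - 1) * (\<Prod>q\<in>P - {p} - {q}. ?s q)"
        using prod.remove[of "P - {p}" q ?s] finite qP 2(2) s[OF qP] by simp
      have "?G * w = ?G * (- (k * (\<Prod>q\<in>P - {p} - {q}. ?s q)))"
        unfolding eq' \<Pi> using k by (simp add: mult.assoc[symmetric])
      then have "w = - (k * (\<Prod>q\<in>P - {p} - {q}. ?s q))"
        using \<open>?G \<noteq> 0\<close> by (simp only: mult_cancel_left) simp
      then have "odd (\<Prod>q\<in>P - {p} - {q}. ?s q)" using assms(3) by auto
      moreover have "odd (\<Prod>q\<in>P - {p} - {q}. ?s q) \<longleftrightarrow> P - {p} - {q} \<subseteq> {2}"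
        using finite prime by (intro odd_prod_col_sum_iff) auto
      ultimately have sub: "P - {p} - {q} \<subseteq> {2}" by simp
      then have "(\<Prod>q\<in>P - {p} - {q}. ?s q) = 1"
        by (intro prod.neutral) auto
      then have eq2: "?G * w = - ((int p + 1) * (int q - 1))"
        using eq' \<Pi> by simp
      have "P - {2} = {p, q}"
        using sub assms(2) qP 2 \<open>2 \<notin> S\<close> by auto
      moreover have "same_2_valuations p q"
        using prime_gt_1_nat[OF prime[OF assms(2)]] prime_gt_1_nat[OF prime[OF qP]] oddS 2 assms(3) G12 eq2
        by (intro same_2_valuations_of_parity[of p q w ?G]) auto
      ultimately show ?thesis
        using 2 S(3) f2 \<open>f p = 1\<close> \<open>r p = 1\<close> by blast
    next
      case 3
      \<comment> \<open>With three or more primes, any two of them besides \<open>p\<close>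
        contribute their factors; this is the hypothesis of \<open>even_of_three_primes\<close>,
        which contradicts odd \<open>w\<close>.\<close>
      have "(int p + 1) * ((int a - 1) * (int b - 1)) dvd ?G * w"
        if "a \<in> S - {p}" "b \<in> S - {p}" "a \<noteq> b" for a b
      proof -
        have "prod ?s {a, b} dvd ?\<Pi>"
          using finite that S(1) by (intro prod_dvd_prod_subset) auto
        moreover have "prod ?s {a, b} = (int a - 1) * (int b - 1)"
          using that S(1) by (auto simp: s subset_iff)
        ultimately show ?thesis
          unfolding eq' by (simp add: mult_dvd_mono)
      qed
      then have "even w"
        using even_of_three_primes[OF S(1) oddS pS 3(1,2,3,4,5) G1 G2] by blast
      then show ?thesis using assms(3) by simp
    qed
  qed
qed

section \<open>Converse: families of exponents with odd Pw\<close>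

lemma odd_Pw_two_power:
  assumes "P = {2}" "f 2 = r 2 \<and> odd (r 2) \<or> f 2 = 1 \<and> 1 < r 2 \<or> even (f 2) \<and> 0 < f 2 \<and> f 2 < r 2"
    and eq: "col_gcd P r f * w = Pw_coeff 2 (r 2) (f 2) * (int 2 + 1) * (\<Prod>q\<in>P - {2}. col_sum q (r q) (f q))"
  shows "odd w"
\<comment> \<open>If \<open>f 2 = 1 < r 2\<close>, the gcd is 2 and the right-hand side is -6;
  otherwise the right-hand side is 3 or -3.\<close>
proof (cases "f 2 = 1 \<and> 1 < r 2")
  case True
  then have "col_gcd P r f = gcd (int 2) (col_gcd (P - {2}) r f)"
    using assms(1) by (intro col_gcd_prime finite f_le r_ge) auto
  then have "col_gcd P r f = 2" using assms(1) by simp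
  then have "w = - 3" using eq True assms(1) by (simp add: Pw_coeff_def)
  then show ?thesis by simp
next
  case False
  then have "col_gcd P r f * w = - 3 \<or> col_gcd P r f * w = 3"
    using assms(2) eq assms(1) r_ge[of 2] by (auto simp: Pw_coeff_def)
  then have "odd (col_gcd P r f * w)" by (elim disjE) (simp_all only:, simp_all)
  then show ?thesis by simp
qed

text \<open>Here the gcd is 2, and at the odd prime \<open>p\<close> the formula reads
  \<open>2 * w = -(p + 1)\<close>, where \<open>p + 1\<close> is 2 modulo 4.\<close>

lemma odd_Pw_two_power_times_prime:
  assumes "P = {2, p}" "p mod 4 = 1" "f p = 1" "r p = 1" "f 2 = 2 \<and> r 2 = 2 \<or> f 2 = 1 \<and> 1 < r 2"
    and eq: "col_gcd P r f * w = Pw_coeff p (r p) (f p) * (int p + 1) * (\<Prod>q\<in>P - {p}. col_sum q (r q) (f q))"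
  shows "odd w"
proof -
  have "p \<noteq> 2" using assms(2) by auto
  then have P: "P - {2} = {p}" "P - {p} = {2}" using assms(1) by auto
  have "col_gcd P r f = gcd (int 2) (col_gcd (P - {2}) r f)"
    using assms(1,5) by (intro col_gcd_prime finite f_le r_ge) auto
  also have "col_gcd (P - {2}) r f = Gcd (insert (int (\<Prod>{p}) + (- 1) ^ (card {p} - 1)) ((\<lambda>p. (int p)\<^sup>2 - 1) ` {p}))"
    unfolding P(1) using assms(1,3,4) prime by (intro col_gcd_squarefree) auto
  also have "gcd (int 2) \<dots> = 2"
  proof -
    have "odd p" using assms(2) by presburger
    then have "2 dvd Gcd (insert (int (\<Prod>{p}) + (- 1) ^ (card {p} - 1)) ((\<lambda>p. (int p)\<^sup>2 - 1) ` {p}))"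
      by (intro Gcd_greatest) auto
    then show ?thesis by (simp add: gcd_proj1_iff del: Gcd_insert)
  qed
  finally have "2 * w = - (int p + 1)"
    using eq assms(3,4) P by (simp add: Pw_coeff_def)
  then show ?thesis using assms(2) by presburger
qed

text \<open>The generators are \<open>p + 1\<close> and its multiple \<open>p^2 - 1\<close>, so the
  gcd is \<open>p + 1\<close> and \<open>w = -1\<close>.\<close>

lemma odd_Pw_prime:
  assumes "p \<in> P" "odd p" "P - {2} = {p}" "f p = 1" "r p = 1" "2 \<in> P \<longrightarrow> f 2 = 0"
    and eq: "col_gcd P r f * w = Pw_coeff p (r p) (f p) * (int p + 1) * (\<Prod>q\<in>P - {p}. col_sum q (r q) (f q))"
  shows "odd w"
proof -
  have "P - {p} \<subseteq> {2}" using assms(3) by auto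
  then have "(\<Prod>q\<in>P - {p}. col_sum q (r q) (f q)) = 1"
    by (intro prod.neutral) auto
  moreover have "col_gcd P r f = int p + 1"
  proof (rule zdvd_antisym_nonneg)
    have G: "col_gcd P r f = Gcd (insert (int (\<Prod>{p}) + (- 1) ^ (card {p} - 1)) ((\<lambda>p. (int p)\<^sup>2 - 1) ` {p}))"
      using assms by (intro col_gcd_eq_Gcd) auto
    have "(int p)\<^sup>2 - 1 = (int p + 1) * (int p - 1)"
      by (simp add: power2_eq_square algebra_simps)
    then show "int p + 1 dvd col_gcd P r f"
      unfolding G by (intro Gcd_greatest) auto
    have "col_gcd P r f dvd int (\<Prod>{p}) + (- 1) ^ (card {p} - 1)"
      unfolding G by (rule Gcd_dvd) simp
    then show "col_gcd P r f dvd int p + 1" by simp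
  qed simp_all
  ultimately have "(int p + 1) * w = (int p + 1) * (- 1)"
    using eq assms(4,5) by (simp add: Pw_coeff_def)
  then have "w = - 1" by (simp only: mult_cancel_left) linarith
  then show ?thesis by simp
qed

text \<open>Apart from \<open>p\<close> and \<open>q\<close> only the prime 2 can occur, and it
  contributes the factor 1. This reduces the claim to
  \<open>odd_of_same_2_valuations\<close>.\<close>

lemma odd_Pw_two_primes:
  assumes "odd p" "odd q" "p \<noteq> q" "P - {2} = {p, q}" "f p = 1" "r p = 1" "f q = 1" "r q = 1"
    and "2 \<in> P \<longrightarrow> f 2 = 0" "same_2_valuations p q"
    and eq: "col_gcd P r f * w = Pw_coeff p (r p) (f p) * (int p + 1) * (\<Prod>q\<in>P - {p}. col_sum q (r q) (f q))"
  shows "odd w"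
proof -
  have PQ: "p \<in> P" "q \<in> P" "P - {p} - {q} \<subseteq> {2}" using assms(4) by auto
  have "(\<Prod>q\<in>P - {p}. col_sum q (r q) (f q)) = col_sum q (r q) (f q) * (\<Prod>q\<in>P - {p} - {q}. col_sum q (r q) (f q))"
    using PQ assms(3) finite by (intro prod.remove) auto
  also have "(\<Prod>q\<in>P - {p} - {q}. col_sum q (r q) (f q)) = 1"
    using PQ(3) by (intro prod.neutral) auto
  finally have "col_gcd P r f * w = - ((int p + 1) * (int q - 1))"
    using eq assms(5-8) by (simp only: Pw_coeff_def) (simp add: col_sum_def[of q] algebra_simps)
  moreover have "x dvd col_gcd P r f"
    if "x dvd int p * int q - 1" "x dvd (int p)\<^sup>2 - 1" "x dvd (int q)\<^sup>2 - 1" for x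
  proof -
    have G: "col_gcd P r f = Gcd (insert (int (\<Prod>{p, q}) + (- 1) ^ (card {p, q} - 1)) ((\<lambda>p. (int p)\<^sup>2 - 1) ` {p, q}))"
      using assms PQ by (intro col_gcd_eq_Gcd) auto
    show ?thesis
      unfolding G using that assms(3) by (intro Gcd_greatest) auto
  qed
  moreover have "p > 1" "q > 1"
    using prime PQ prime_gt_1_nat by blast+
  ultimately show ?thesis
    using odd_of_same_2_valuations[of p q "col_gcd P r f" w] assms(1,2,10) by blast
qed

end

section \<open>The case list of h in uniform shape\<close>

text \<open>
  The cases with value \<open>2\<close> of both \<open>h1\<close> and \<open>h2\<close>: \<open>d = N\<close> is \<open>b = a\<close> in the first, \<open>a = 2\<close> and
  \<open>d = 4 p\<close> in the second, and \<open>a = 0\<close> in the last two.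
\<close>

definition h_cond :: "nat \<Rightarrow> nat \<Rightarrow> bool" where
  "h_cond N d \<longleftrightarrow>
    (\<exists>a b. N = 2 ^ a \<and> d = 2 ^ b \<and> (b = a \<and> odd a \<or> b = 1 \<and> 1 < a \<or> even b \<and> b < a)) \<or>
    (\<exists>a p. prime p \<and> p mod 4 = 1 \<and> N = 2 ^ a * p \<and> (a = 2 \<and> d = 4 * p \<or> 2 \<le> a \<and> d = 2 * p)) \<or>
    (\<exists>a p. prime p \<and> odd p \<and> N = 2 ^ a * p \<and> d = p) \<or>
    (\<exists>a p q. prime p \<and> prime q \<and> odd p \<and> odd q \<and> p \<noteq> q \<and> N = 2 ^ a * (p * q) \<and> d = p * q \<and>
       same_2_valuations p q)"

lemma h2_eq_2_iff:
  assumes "N > 0" "d dvd N" "d \<noteq> 1"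
  shows "h2 N d = 2 \<longleftrightarrow> h_cond N d"
proof (cases "d = N")
  case True
  have "h1 N = 2 \<longleftrightarrow> h_cond N N"
  proof
    assume "h1 N = 2"
    then consider "prime N" | r where "odd r" "N = 2 ^ r"
      | p q where "prime p" "prime q" "odd p" "odd q" "p \<noteq> q" "N = p * q" "same_2_valuations p q"
      | p where "prime p" "p mod 4 = 1" "N = 4 * p"
      unfolding h1_def cong_def by (auto split: if_splits)
    then show "h_cond N N"
    proof cases
      case 1
      show ?thesis
      proof (cases "N = 2")
        case True
        then have "N = 2 ^ 1 \<and> N = 2 ^ 1 \<and> ((1::nat) = 1 \<and> odd (1::nat))" by simp
        then show ?thesis unfolding h_cond_def by blast
      next
        case False
        then have "N = 2 ^ 0 * N" "odd N" using prime_odd_or_2[OF 1] by auto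
        then show ?thesis unfolding h_cond_def using 1 by blast
      qed
    next
      case 2
      then show ?thesis unfolding h_cond_def by blast
    next
      case 3
      then have "N = 2 ^ 0 * (p * q)" by simp
      then show ?thesis unfolding h_cond_def using 3 by blast
    next
      case 4
      then have "N = 2 ^ 2 * p" by simp
      then show ?thesis unfolding h_cond_def using 4 by blast
    qed
  next
    assume "h_cond N N"
    then consider a b where "N = 2 ^ a" "N = 2 ^ b" "b = a \<and> odd a \<or> b = 1 \<and> 1 < a \<or> even b \<and> b < a"
      | a p where "prime p" "p mod 4 = 1" "N = 2 ^ a * p" "a = 2 \<and> N = 4 * p \<or> 2 \<le> a \<and> N = 2 * p"
      | p where "prime p" "N = p"
      | p q where "prime p" "prime q" "odd p" "odd q" "p \<noteq> q" "N = p * q" "same_2_valuations p q"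
      unfolding h_cond_def by blast
    then show "h1 N = 2"
    proof cases
      case 1
      \<comment> \<open>With equal exponents only the alternative \<open>b = a\<close> with
        \<open>a\<close> odd survives.\<close>
      then have "a = b" by (metis one_less_numeral_iff power_inject_exp semiring_norm(76))
      then show ?thesis using 1 by (auto simp: h1_def)
    next
      case 2
      \<comment> \<open>\<open>N = 2 * p\<close> would need \<open>a = 1\<close>, against
        \<open>2 <= a\<close>.\<close>
      have "a = 2 \<and> N = 4 * p"
      proof (rule ccontr)
        assume "\<not> ?thesis"
        then have "2 \<le> a" "2 ^ a * p = 2 ^ 1 * p" using 2 by auto
        then have "(2 :: nat) ^ a = 2 ^ 1" using 2(1) not_prime_0 by (metis mult_cancel2)
        then have "a = 1" by (simp only: power_inject_exp)
        then show False using \<open>2 \<le> a\<close> by simp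
      qed
      then show ?thesis using 2 by (auto simp: h1_def cong_def)
    next
      case 3
      then show ?thesis by (auto simp: h1_def)
    next
      case 4
      then show ?thesis unfolding h1_def by auto
    qed
  qed
  then show ?thesis using True by (simp add: h2_def)
next
  case False
  show ?thesis
  proof
    assume "h2 N d = 2"
    then consider r where "r \<ge> 2" "N = 2 ^ r" "d = 2"
      | r f where "r \<ge> 2" "N = 2 ^ r" "even f" "d = 2 ^ f"
      | r p where "r \<ge> 2" "prime p" "p mod 4 = 1" "N = 2 ^ r * p" "d = 2 * p"
      | r where "N = 2 ^ r * d" "prime d" "odd d"
      | r p q where "prime p" "prime q" "odd p" "odd q" "p \<noteq> q" "N = 2 ^ r * d" "d = p * q" "same_2_valuations p q"
      unfolding h2_def cong_def using False by (auto split: if_splits)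
    then show "h_cond N d"
    proof cases
      case 1
      then have "N = 2 ^ r \<and> d = 2 ^ 1 \<and> (1::nat) = 1 \<and> 1 < r" by simp
      then show ?thesis unfolding h_cond_def by blast
    next
      case 2
      then have "f \<le> r" using assms(2) by (simp add: power_dvd_imp_le)
      moreover have "f \<noteq> r" using 2 False by auto
      ultimately have "f < r" by simp
      then show ?thesis unfolding h_cond_def using 2 by blast
    next
      case 3
      then show ?thesis unfolding h_cond_def by blast
    next
      case 4
      then show ?thesis unfolding h_cond_def by blast
    next
      case 5
      then have "N = 2 ^ r * (p * q)" by simp
      then show ?thesis unfolding h_cond_def using 5 by blast
    qed
  next
    assume "h_cond N d"
    then consider a b where "N = 2 ^ a" "d = 2 ^ b" "b = a \<and> odd a \<or> b = 1 \<and> 1 < a \<or> even b \<and> b < a"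
      | a p where "prime p" "p mod 4 = 1" "N = 2 ^ a * p" "a = 2 \<and> d = 4 * p \<or> 2 \<le> a \<and> d = 2 * p"
      | a where "prime d" "odd d" "N = 2 ^ a * d"
      | a p q where "prime p" "prime q" "odd p" "odd q" "p \<noteq> q" "N = 2 ^ a * (p * q)" "d = p * q" "same_2_valuations p q"
      unfolding h_cond_def by blast
    then show "h2 N d = 2"
    proof cases
      case 1
      then have "b \<noteq> a" using False by auto
      \<comment> \<open>\<open>b = 0\<close> would mean \<open>d = 1\<close>; hence an even
        \<open>b\<close> below \<open>a\<close> also gives \<open>a >= 2\<close>.\<close>
      moreover have "b \<noteq> 0" using 1 assms(3) by (intro notI) simp
      ultimately have "a \<ge> 2" "d = 2 \<or> even b" using 1 by (auto elim: evenE)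
      then show ?thesis unfolding h2_def using False 1 by auto
    next
      case 2
      then have "2 \<le> a \<and> d = 2 * p" using False by auto
      then show ?thesis unfolding h2_def cong_def using False 2 by auto
    next
      case 3
      then have "a \<ge> 1" using False by (cases a) auto
      then show ?thesis unfolding h2_def using False 3 by auto
    next
      case 4
      then have "a \<ge> 1" using False by (cases a) auto
      moreover have "N = 2 ^ a * d" using 4 by simp
      ultimately show ?thesis
        unfolding h2_def if_not_P[OF False] using 4 by (intro if_P disjI2) blast
    qed
  qed
qed

section \<open>Comparison of Pw with the case list\<close>

lemma prime_factors_two_power_mult:
  fixes M :: nat
  assumes "odd M"
  shows "prime_factors (2 ^ a * M) = (if a = 0 then {} else {2}) \<union> prime_factors M"
    "multiplicity 2 (2 ^ a * M) = a"
    "\<And>q. prime q \<Longrightarrow> odd q \<Longrightarrow> multiplicity q (2 ^ a * M) = multiplicity q M"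
proof -
  have "M \<noteq> 0" using assms by (intro notI) simp
  then show "prime_factors (2 ^ a * M) = (if a = 0 then {} else {2}) \<union> prime_factors M"
    by (auto simp: prime_factorization_mult prime_factorization_prime_power)
  show "multiplicity 2 (2 ^ a * M) = a"
    using assms \<open>M \<noteq> 0\<close> by (simp add: prime_elem_multiplicity_mult_distrib not_dvd_imp_multiplicity_0)
  show "multiplicity q (2 ^ a * M) = multiplicity q M" if "prime q" "odd q" for q
  proof -
    have "q \<noteq> 2" using that by auto
    then show ?thesis
      using that \<open>M \<noteq> 0\<close> by (simp add: prime_elem_multiplicity_mult_distrib multiplicity_distinct_prime_power)
  qed
qed

text \<open>Primes not dividing \<open>N\<close> have \<open>Pw = 0\<close>. If some
  \<open>Pw\<close> is odd, \<open>N\<close> and \<open>d\<close> are rebuilt from the exponents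
  found; conversely each family exhibits one prime with odd \<open>Pw\<close>: 2 for powers of 2,
  and the odd prime \<open>p\<close> otherwise.\<close>

lemma h_div_eq_2_iff:
  assumes "N > 0" "d dvd N" "d \<noteq> 1"
  shows "h_div N (C_div N d) = 2 \<longleftrightarrow> h_cond N d"
proof -
  let ?P = "prime_factors N" and ?r = "\<lambda>p. multiplicity p N" and ?f = "\<lambda>p. multiplicity p d"
  let ?Pw = "\<lambda>p. Pw_div N p (C_div N d)"
  have "d > 0" using assms by (auto intro: dvd_pos_nat)
  interpret local_data ?P ?r ?f
    by unfold_locales (simp, use assms in \<open>auto simp: prime_factors_multiplicity dvd_imp_multiplicity_le\<close>)
  note eq = col_gcd_mult_Pw_div_prime[OF assms]
  have "h_div N (C_div N d) = 2 \<longleftrightarrow> (\<exists>p. prime p \<and> odd (?Pw p))"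
    by (auto simp: h_div_def)
  also have "\<dots> \<longleftrightarrow> (\<exists>p\<in>?P. odd (?Pw p))"
    using Pw_div_not_prime_factor[OF _ _ assms(1)] prime by (metis even_zero)
  also have "\<dots> \<longleftrightarrow> h_cond N d"
  proof
    assume "\<exists>p\<in>?P. odd (?Pw p)"
    then obtain p where p: "p \<in> ?P" "odd (?Pw p)" by blast
    have N: "N = (\<Prod>q\<in>?P. q ^ ?r q)"
      using assms(1) by (rule prime_factorization_nat)
    have sub: "prime_factors d \<subseteq> ?P"
      using assms by (intro dvd_prime_factors) auto
    have "d = (\<Prod>q\<in>prime_factors d. q ^ ?f q)"
      using \<open>d > 0\<close> by (rule prime_factorization_nat)
    also have "\<dots> = (\<Prod>q\<in>?P. q ^ ?f q)"
      using sub by (intro prod.mono_neutral_left) (simp, simp, auto simp: prime_factors_multiplicity)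
    finally have d: "d = (\<Prod>q\<in>?P. q ^ ?f q)" .
    have ex: "\<exists>q\<in>?P. ?f q > 0"
    proof -
      obtain q where "prime q" "q dvd d"
        using assms(3) by (metis prime_factor_nat)
      then have "q \<in> ?P" "?f q > 0"
        using sub \<open>d > 0\<close> by (auto simp: prime_multiplicity_gt_zero_iff in_prime_factors_iff)
      then show ?thesis by blast
    qed
    \<comment> \<open>Splitting off the 2-part treats odd and even \<open>N\<close> together, with
      exponent 0 if \<open>N\<close> is odd.\<close>
    have two_part: "(\<Prod>q\<in>?P. q ^ g q) = 2 ^ (if 2 \<in> ?P then g 2 else 0) * (\<Prod>q\<in>?P - {2}. q ^ g q)"
      for g :: "nat \<Rightarrow> nat"
      by (cases "2 \<in> ?P") (simp_all add: prod.remove)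
    have odd_P: "odd q" if "q \<in> ?P - {2}" for q
      using that prime prime_odd_or_2 by blast
    show "h_cond N d"
      using odd_Pw_imp[OF ex p eq[OF p(1)]]
    proof (elim disjE exE)
      assume *: "?P = {2} \<and> (?f 2 = ?r 2 \<and> odd (?r 2) \<or> ?f 2 = 1 \<and> 1 < ?r 2 \<or>
        even (?f 2) \<and> 0 < ?f 2 \<and> ?f 2 < ?r 2)"
      then have "N = 2 ^ ?r 2" "d = 2 ^ ?f 2"
        using N d by simp_all
      then show ?thesis using * unfolding h_cond_def by blast
    next
      fix q
      assume *: "q mod 4 = 1 \<and> ?P = {2, q} \<and> ?f q = 1 \<and> ?r q = 1 \<and>
        (?f 2 = 2 \<and> ?r 2 = 2 \<or> ?f 2 = 1 \<and> 1 < ?r 2)"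
      then have "q \<noteq> 2" by auto
      then have "N = 2 ^ ?r 2 * q" "d = 2 ^ ?f 2 * q"
        using N d * by simp_all
      moreover have "prime q" using * prime by blast
      moreover have "?r 2 = 2 \<and> d = 4 * q \<or> 2 \<le> ?r 2 \<and> d = 2 * q"
        using * \<open>d = 2 ^ ?f 2 * q\<close> by auto
      ultimately show ?thesis using * unfolding h_cond_def by blast
    next
      fix q
      assume *: "odd q \<and> ?P - {2} = {q} \<and> ?f q = 1 \<and> ?r q = 1 \<and> (2 \<in> ?P \<longrightarrow> ?f 2 = 0)"
      then have "(if 2 \<in> ?P then ?f 2 else 0) = 0" by simp
      then have "N = 2 ^ (if 2 \<in> ?P then ?r 2 else 0) * q" "d = q"
        using trans[OF N two_part] trans[OF d two_part] * by simp_all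
      moreover have "prime q" using * prime by blast
      ultimately show ?thesis using * unfolding h_cond_def by blast
    next
      fix q q'
      assume *: "q \<noteq> q' \<and> ?P - {2} = {q, q'} \<and> ?f q = 1 \<and> ?r q = 1 \<and> ?f q' = 1 \<and> ?r q' = 1 \<and>
        (2 \<in> ?P \<longrightarrow> ?f 2 = 0) \<and> same_2_valuations q q'"
      then have "(if 2 \<in> ?P then ?f 2 else 0) = 0" by simp
      then have "N = 2 ^ (if 2 \<in> ?P then ?r 2 else 0) * (q * q')" "d = q * q'"
        using trans[OF N two_part] trans[OF d two_part] * by simp_all
      moreover have "prime q" "prime q'" using * prime by blast+
      moreover have "odd q" "odd q'" using * odd_P by blast+
      ultimately show ?thesis using * unfolding h_cond_def by blast
    qed
  next
    assume "h_cond N d"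
    then consider a b where "N = 2 ^ a" "d = 2 ^ b" "b = a \<and> odd a \<or> b = 1 \<and> 1 < a \<or> even b \<and> b < a"
      | a p where "prime p" "p mod 4 = 1" "N = 2 ^ a * p" "a = 2 \<and> d = 4 * p \<or> 2 \<le> a \<and> d = 2 * p"
      | a p where "prime p" "odd p" "N = 2 ^ a * p" "d = p"
      | a p q where "prime p" "prime q" "odd p" "odd q" "p \<noteq> q" "N = 2 ^ a * (p * q)" "d = p * q" "same_2_valuations p q"
      unfolding h_cond_def by blast
    then show "\<exists>p\<in>?P. odd (?Pw p)"
    proof cases
      case 1
      have "b \<noteq> 0" using 1 assms(3) by (intro notI) simp
      then have "a \<noteq> 0" using 1(3) by auto
      have P: "?P = {2}" "?r 2 = a" "?f 2 = b"
        using 1(1,2) \<open>a \<noteq> 0\<close> by (simp_all add: prime_factorization_prime_power)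
      have "odd (?Pw 2)"
        using odd_Pw_two_power[OF P(1) _ eq[of 2]] P 1(3) \<open>b \<noteq> 0\<close> by simp
      then show ?thesis using P(1) by blast
    next
      case 2
      have "odd p" using 2(2) by presburger
      have "a \<ge> 2" using 2(4) by auto
      obtain b where b: "d = 2 ^ b * p" "a = 2 \<and> b = 2 \<or> 2 \<le> a \<and> b = 1"
      proof (cases "a = 2 \<and> d = 4 * p")
        case True
        then show ?thesis using that[of 2] by simp
      next
        case False
        then have "2 \<le> a \<and> d = 2 * p" using 2(4) by blast
        then show ?thesis using that[of 1] by simp
      qed
      have P: "?P = {2, p}" "?r 2 = a" "?r p = 1" "?f 2 = b" "?f p = 1"
        unfolding 2(3) b(1) using prime_factors_two_power_mult[OF \<open>odd p\<close>] 2(1) \<open>odd p\<close> \<open>a \<ge> 2\<close>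
        by (simp_all add: prime_factorization_prime insert_commute)
      have "odd (?Pw p)"
        using odd_Pw_two_power_times_prime[OF P(1) 2(2) P(5,3) _ eq[of p]] P b(2) by auto
      then show ?thesis using P(1) by blast
    next
      case 3
      have P: "?P = (if a = 0 then {} else {2}) \<union> {p}" "?r p = 1" "?f p = 1"
        unfolding 3(3,4) using prime_factors_two_power_mult[OF 3(2)] 3(1,2)
        by (simp_all add: prime_factorization_prime)
      have P2: "p \<in> ?P" "?P - {2} = {p}" "2 \<in> ?P \<longrightarrow> ?f 2 = 0"
        using P(1) 3(2,4) by (auto simp: not_dvd_imp_multiplicity_0)
      have "odd (?Pw p)"
        by (rule odd_Pw_prime[OF P2(1) 3(2) P2(2) P(3,2) P2(3) eq[OF P2(1)]])
      then show ?thesis using P2(1) by blast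
    next
      case 4
      have odd: "odd (p * q)" using 4 by simp
      have "p * q \<noteq> 0" using 4 by (auto dest: prime_gt_0_nat)
      then have pq: "prime_factors (p * q) = {p, q}" "multiplicity p (p * q) = 1" "multiplicity q (p * q) = 1"
        using 4(1,2,5) by (auto simp: prime_factorization_mult prime_factorization_prime
            prime_elem_multiplicity_mult_distrib prime_multiplicity_other)
      have P: "?P = (if a = 0 then {} else {2}) \<union> {p, q}" "?r p = 1" "?r q = 1" "?f p = 1" "?f q = 1"
        unfolding 4(6,7) using prime_factors_two_power_mult[OF odd] 4(1-4) pq by simp_all
      have P2: "p \<in> ?P" "?P - {2} = {p, q}" "2 \<in> ?P \<longrightarrow> ?f 2 = 0"
        using P(1) 4(3,4) odd 4(7) by (auto simp: not_dvd_imp_multiplicity_0)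
      have "odd (?Pw p)"
        by (rule odd_Pw_two_primes[OF 4(3-5) P2(2) P(4,2,5,3) P2(3) 4(8) eq[OF P2(1)]])
      then show ?thesis using P2(1) by blast
    qed
  qed
  finally show ?thesis .
qed

theorem theorem3p22:
  fixes N d :: nat
  assumes "N > 0" and "d dvd N" and "d \<noteq> 1"
  shows "GCD_div N (C_div N d) = g2 N d \<and> h_div N (C_div N d) = h2 N d"
proof
  show "GCD_div N (C_div N d) = g2 N d"
    by (rule GCD_div_eq_g2[OF assms])
  \<comment> \<open>Both invariants take only the values 1 and 2, so it suffices to compare when
    they equal 2.\<close>
  have "h_div N (C_div N d) \<in> {1, 2}"
    by (simp add: h_div_def)
  moreover have "h2 N d \<in> {1, 2}"
    by (simp add: h2_def h1_def)
  moreover have "h_div N (C_div N d) = 2 \<longleftrightarrow> h2 N d = 2"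
    unfolding h_div_eq_2_iff[OF assms] h2_eq_2_iff[OF assms] ..
  ultimately show "h_div N (C_div N d) = h2 N d" by auto
qed

end
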